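(* Let $\mathbb{F}_q$ be a finite field, and let $m_0,m_1,m_2$ be nonnegative integers and $m_3,m_4,m_5,m_6$ positive integers with $m_0\le\min(m_3,m_4)$, $m_1\le\min(m_4,m_5)$, $m_2\le\min(m_6,m_3)$, and $m_2<m_0$. Then there exist positive integers $l_n$, nonnegative integers $k_n$, and a sequence of codes $\Phi_n$ ($n=1,2,\dots$) of block-length $l_n$ on $\mathbb{F}_q$ with message set $\mathbb{F}_q^{k_n}$ such that $$\lim_{n\to\infty}\frac{k_n}{l_n}=m_0-m_2,$$ $$\lim_{n\to\infty}\max_{\boldsymbol K}P_e[\Phi_n,\boldsymbol K,0,0]=\lim_{n\to\infty}\max_{\boldsymbol K,\boldsymbol H}P_e[\Phi_n,\boldsymbol K,\boldsymbol H,0]=0,$$ and, for every $n$, $$\max_{\boldsymbol K,\boldsymbol H}\ \max_{\alpha^n}\ I(M;Y_E)[\Phi_n,\boldsymbol K,\boldsymbol H,\alpha^n]=0.$$ Here the maxima over $\boldsymbol K=(K_B,K_E)$ and $\boldsymbol H=(H_B,H_E)$ are over all $(K_B,H_B,K_E,H_E)\in\mathbb{F}_q^{m_4\times m_3}\times\mathbb{F}_q^{m_4\times m_5}\times\mathbb{F}_q^{m_6\times m_3}\times\mathbb{F}_q^{m_6\times m_5}$ satisfying $\operatorname{rank}K_B=m_0$, $\operatorname{rank}H_B=m_1$, $\operatorname{rank}K_E=m_2$ (in the maximum over $\boldsymbol K$ alone, only the conditions on $K_B,K_E$ apply and $\boldsymbol H=0$), and $\max_{\alpha^n}$ is over all of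 Eve's strategies for block-length $l_n$ (relative to $K_E,H_E$).
   Context: Network model. A sender (Alice), a receiver (Bob) and an adversary (Eve) are connected by a network that acts linearly over $\mathbb{F}_q$. The network is used $l$ times with the same matrices. Alice's input is a matrix $X\in\mathbb{F}_q^{m_3\times l}$, Eve injects a matrix $Z\in\mathbb{F}_q^{m_5\times l}$, Bob receives $Y_B\in\mathbb{F}_q^{m_4\times l}$ and Eve observes $Y_E\in\mathbb{F}_q^{m_6\times l}$, where $$Y_B=K_BX+H_BZ,\qquad Y_E=K_EX+H_EZ,$$ with $K_B\in\mathbb{F}_q^{m_4\times m_3}$, $H_B\in\mathbb{F}_q^{m_4\times m_5}$, $K_E\in\mathbb{F}_q^{m_6\times m_3}$, $H_E\in\mathbb{F}_q^{m_6\times m_5}$. Write $\boldsymbol K=(K_B,K_E)$ and $\boldsymbol H=(H_B,H_E)$; $\boldsymbol H=0$ means $H_B=0$ and $H_E=0$. Strategy. A strategy of Eve for block-length $l$ (relative to $K_E,H_E$) is a function $\alpha:\mathbb{F}_q^{m_6\times l}\to\mathbb{F}_q^{m_5\times l}$ satisfying the uniqueness condition: for every $X\in\mathbb{F}_q^{m_3\times l}$ there is exactly one $Y_E\in\mathbb{F}_q^{m_6\times l}$ with $Y_E=K_EX+H_E\,\alpha(Y_E)$. Under strategy $\alpha$, Eve's observation is this $Y_E$ and her injected noise is $Z=\alpha(Y_E)$. The strategy $0$ (passive attack) is the one with $Z=0$ always. Code. A (non-local) code of block-length $l$ is a pair $\Phi=(\phi,\psi)$ consisting of an encoder $\phi:\mathcal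 M\times\mathcal L\to\mathbb{F}_q^{m_3\times l}$ and a decoder $\psi:\mathbb{F}_q^{m_4\times l}\to\mathcal M$, where $\mathcal M$ is the finite message set and $\mathcal L$ is a finite set of values of a scramble random number. The message $M$ and the scramble random number $L$ are independent and uniformly distributed on $\mathcal M$ and $\mathcal L$, and Alice inputs $X=\phi(M,L)$. Quantities. $P_e[\Phi,\boldsymbol K,\boldsymbol H,\alpha]$ is the decoding error probability $\Pr\{\psi(Y_B)\ne M\}$, and $I(M;Y_E)[\Phi,\boldsymbol K,\boldsymbol H,\alpha]$ is the mutual information between $M$ and Eve's observation $Y_E$ (since $Z$ is a function of $Y_E$, it equals $I(M;Y_E,Z)$), both when code $\Phi$ is used and Eve uses strategy $\alpha$. *)

theory Defs
  imports "HOL-Probability.Information" "Jordan_Normal_Form.DL_Rank"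
begin

text \<open>
  Dimensions and block-lengths are natural numbers, hence matrices are those of
  \<^theory>\<open>Jordan_Normal_Form.Matrix\<close>. The network is described by the pairs
  \<open>K = (KB, KE)\<close> and \<open>H = (HB, HE)\<close>.
\<close>

type_synonym 'a mat_pair = "'a mat \<times> 'a mat"

definition K_set :: "nat \<Rightarrow> nat \<Rightarrow> nat \<Rightarrow> nat \<Rightarrow> nat \<Rightarrow> 'a :: field mat_pair set" where
  "K_set m0 m2 m3 m4 m6 =
     {(KB, KE). KB \<in> carrier_mat m4 m3 \<and> KE \<in> carrier_mat m6 m3 \<and>
        vec_space.rank m4 KB = m0 \<and> vec_space.rank m6 KE = m2}"

definition H_set :: "nat \<Rightarrow> nat \<Rightarrow> nat \<Rightarrow> nat \<Rightarrow> 'a :: field mat_pair set" where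
  "H_set m1 m4 m5 m6 =
     {(HB, HE). HB \<in> carrier_mat m4 m5 \<and> HE \<in> carrier_mat m6 m5 \<and>
        vec_space.rank m4 HB = m1}"

definition zero_H :: "nat \<Rightarrow> nat \<Rightarrow> nat \<Rightarrow> 'a :: field mat_pair" where
  "zero_H m4 m5 m6 = (0\<^sub>m m4 m5, 0\<^sub>m m6 m5)"

text \<open>Strategies are extensional functions, so that there are only finitely many of them.\<close>

definition strategies :: "nat \<Rightarrow> 'a :: field mat \<Rightarrow> 'a mat \<Rightarrow> ('a mat \<Rightarrow> 'a mat) set" where
  "strategies l KE HE =
     {\<alpha> \<in> carrier_mat (dim_row KE) l \<rightarrow>\<^sub>E carrier_mat (dim_col HE) l.
        \<forall>X \<in> carrier_mat (dim_col KE) l.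
          \<exists>!Y. Y \<in> carrier_mat (dim_row KE) l \<and> Y = KE * X + HE * \<alpha> Y}"

definition zero_strategy :: "nat \<Rightarrow> nat \<Rightarrow> nat \<Rightarrow> 'a :: field mat \<Rightarrow> 'a mat" where
  "zero_strategy m5 m6 l = (\<lambda>Y \<in> carrier_mat m6 l. 0\<^sub>m m5 l)"

definition eve_obs ::
  "'a :: field mat_pair \<Rightarrow> 'a mat_pair \<Rightarrow> ('a mat \<Rightarrow> 'a mat) \<Rightarrow> 'a mat \<Rightarrow> 'a mat" where
  "eve_obs K H \<alpha> X =
     (THE Y. Y \<in> carrier_mat (dim_row (snd K)) (dim_col X) \<and> Y = snd K * X + snd H * \<alpha> Y)"

definition bob_obs ::
  "'a :: field mat_pair \<Rightarrow> 'a mat_pair \<Rightarrow> ('a mat \<Rightarrow> 'a mat) \<Rightarrow> 'a mat \<Rightarrow> 'a mat" where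
  "bob_obs K H \<alpha> X = fst K * X + fst H * \<alpha> (eve_obs K H \<alpha> X)"

record ('a, 'm, 's) net_code =
  messages :: "'m set"
  scrambles :: "'s set"
  encode :: "'m \<times> 's \<Rightarrow> 'a mat"
  decode :: "'a mat \<Rightarrow> 'm"

definition is_code :: "nat \<Rightarrow> nat \<Rightarrow> nat \<Rightarrow> ('a :: field, 'm, 's) net_code \<Rightarrow> bool" where
  "is_code m3 m4 l \<Phi> \<longleftrightarrow>
     finite (messages \<Phi>) \<and> messages \<Phi> \<noteq> {} \<and>
     finite (scrambles \<Phi>) \<and> scrambles \<Phi> \<noteq> {} \<and>
     encode \<Phi> \<in> messages \<Phi> \<times> scrambles \<Phi> \<rightarrow> carrier_mat m3 l \<and>
     decode \<Phi> \<in> carrier_mat m4 l \<rightarrow> messages \<Phi>"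

text \<open>
  The uniform distribution on the product is the joint distribution of an independent,
  uniformly distributed message and scramble random number, which are the two projections.
\<close>

definition code_space :: "('a, 'm, 's) net_code \<Rightarrow> ('m \<times> 's) measure" where
  "code_space \<Phi> = uniform_count_measure (messages \<Phi> \<times> scrambles \<Phi>)"

definition error_prob ::
  "('a :: field, 'm, 's) net_code \<Rightarrow> 'a mat_pair \<Rightarrow> 'a mat_pair \<Rightarrow> ('a mat \<Rightarrow> 'a mat) \<Rightarrow> real" where
  "error_prob \<Phi> K H \<alpha> =
     \<P>(\<omega> in code_space \<Phi>. decode \<Phi> (bob_obs K H \<alpha> (encode \<Phi> \<omega>)) \<noteq> fst \<omega>)"

text \<open>
  Mutual information in bits. The count spaces on the (finite) ranges of the two random
  variables are those of the notation \<open>\<I>(_ ; _)\<close> in the locale \<^locale>\<open>information_space\<close>.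
\<close>

definition leaked_info ::
  "('a :: field, 'm, 's) net_code \<Rightarrow> 'a mat_pair \<Rightarrow> 'a mat_pair \<Rightarrow> ('a mat \<Rightarrow> 'a mat) \<Rightarrow> real" where
  "leaked_info \<Phi> K H \<alpha> =
     (let \<Omega> = code_space \<Phi>; YE = (\<lambda>\<omega>. eve_obs K H \<alpha> (encode \<Phi> \<omega>))
      in prob_space.mutual_information \<Omega> 2
           (count_space (fst ` space \<Omega>)) (count_space (YE ` space \<Omega>)) fst YE)"

text \<open>The sets over which maxima are taken are finite.\<close>

lemma finite_carrier_mat: "finite (carrier_mat r c :: 'a :: {field, finite} mat set)"
proof -
  let ?I = "{..<r} \<times> {..<c}"
  let ?f = "\<lambda>A :: 'a mat. restrict (($$) A) ?I"
  have "inj_on ?f (carrier_mat r c)"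
  proof (rule inj_onI)
    fix A B :: "'a mat"
    assume A: "A \<in> carrier_mat r c" and B: "B \<in> carrier_mat r c" and eq: "?f A = ?f B"
    show "A = B"
    proof (rule eq_matI)
      fix i j assume "i < dim_row B" "j < dim_col B"
      with B show "A $$ (i, j) = B $$ (i, j)"
        using fun_cong[OF eq, of "(i, j)"] by auto
    qed (use A B in auto)
  qed
  moreover have "?f ` carrier_mat r c \<subseteq> ?I \<rightarrow>\<^sub>E UNIV"
    by (rule image_subsetI) (simp add: restrict_PiE_iff)
  moreover have "finite (?I \<rightarrow>\<^sub>E (UNIV :: 'a set))"
    by (intro finite_PiE) auto
  ultimately show ?thesis
    by (meson finite_subset inj_on_finite)
qed

lemma finite_K_set: "finite (K_set m0 m2 m3 m4 m6 :: 'a :: {field, finite} mat_pair set)"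
  by (rule finite_subset[of _ "carrier_mat m4 m3 \<times> carrier_mat m6 m3"])
    (auto simp: K_set_def finite_carrier_mat)

lemma finite_H_set: "finite (H_set m1 m4 m5 m6 :: 'a :: {field, finite} mat_pair set)"
  by (rule finite_subset[of _ "carrier_mat m4 m5 \<times> carrier_mat m6 m5"])
    (auto simp: H_set_def finite_carrier_mat)

lemma finite_strategies:
  "finite (strategies l KE HE :: ('a :: {field, finite} mat \<Rightarrow> 'a mat) set)"
  unfolding strategies_def
  by (rule finite_subset[OF Collect_subset]) (auto intro!: finite_PiE finite_carrier_mat)

lemma zero_strategy_in_strategies:
  assumes "KE \<in> carrier_mat m6 m3" "HE \<in> carrier_mat m6 m5"
  shows "zero_strategy m5 m6 l \<in> strategies l KE HE"
  using assms by (auto simp: strategies_def zero_strategy_def)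

end

theory Submission
  imports Defs "HOL-Algebra.Algebraic_Closure_Type" "HOL-Real_Asymp.Real_Asymp"
begin

unbundle no vec_syntax
no_notation fps_nth (infixl "$" 75)

text \<open>
  A Gabidulin code with an identity header achieves the rate with zero error. Let \<open>F\<close> be the
  extension of degree \<open>d\<close> of the field with \<open>q\<close> elements, and let \<open>g\<^sub>0, \<dots>\<close> be a basis of it. Message and
  scramble number are the coefficients \<open>u\<^sub>j\<close> with \<open>m\<^sub>2 \<le> j < m\<^sub>0\<close> and with \<open>j < m\<^sub>2\<close> of a linearized
  polynomial \<open>f x = (\<Sum>j<m\<^sub>0. u\<^sub>j * x ^ (q ^ j))\<close> over \<open>F\<close>, and Alice sends the values \<open>f g\<^sub>i\<close> for
  \<open>i < m\<^sub>3\<close>. As \<open>f\<close> is linear over the small field, a matrix \<open>K\<close> applied to these values yields the values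
  of \<open>f\<close> on a subspace with as many elements as the row space of \<open>K\<close>.

  Bob reads \<open>K\<^sub>B\<close> off the header and knows \<open>f\<close> at \<open>q ^ m\<^sub>0\<close> points, more than its degree, which
  determines \<open>f\<close>. Eve knows \<open>f\<close> on a subspace \<open>W\<close> of dimension \<open>m\<^sub>2\<close>; by the same root count, the
  scramble coefficients are determined by the values on a basis of \<open>W\<close> once the message is fixed, and
  by counting every tuple of values occurs exactly once. So \<open>K\<^sub>E X\<close> has the same distribution for all
  messages, and under any strategy Eve's observation is a function of \<open>K\<^sub>E X\<close>. The header and the choice of
  \<open>d\<close> cost nothing in the limit: the rate is \<open>d (m\<^sub>0 - m\<^sub>2) / (m\<^sub>3 + d)\<close>.
\<close>

section \<open>A subfield of given degree in the algebraic closure\<close>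

lemma power_CARD:
  fixes x :: "'a :: {field, finite}"
  shows "x ^ CARD('a) = x"
proof (cases "x = 0")
  case False
  have "x * (\<Prod>y\<in>UNIV-{0}. x * y) = x * x ^ (CARD('a) - 1) * \<Prod>(UNIV-{0})"
    by (simp add: prod.distrib mult_ac)
  also have "x * x ^ (CARD('a) - 1) = x ^ CARD('a)"
    by (simp flip: power_Suc)
  \<comment> \<open>Multiplication by a nonzero \<open>x\<close> permutes the nonzero elements, so
    their product cancels.\<close>
  also have "(\<Prod>y\<in>UNIV-{0}. x * y) = (\<Prod>y\<in>UNIV-{0}. y)"
    by (rule prod.reindex_bij_witness[of _ "\<lambda>y. y / x" "\<lambda>y. x * y"]) (use False in auto)
  finally show ?thesis
    by simp
qed simp

lemma CARD_field_gt_1: "1 < CARD('a :: {field, finite})"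
proof -
  have "card {0, 1 :: 'a} \<le> CARD('a)"
    by (intro card_mono) auto
  then show ?thesis by simp
qed

lemma CARD_choose_eq_0:
  assumes "0 < k" "k < CARD('a)"
  shows "of_nat (CARD('a) choose k) = (0 :: 'a :: {field, finite})"
proof -
  let ?q = "CARD('a)"
  \<comment> \<open>\<open>p = (x + 1) ^ q - x ^ q - 1\<close> has degree below \<open>q\<close> and vanishes on the whole field.\<close>
  define p :: "'a poly" where "p = (\<Sum>i\<in>{1..<?q}. Polynomial.monom (of_nat (?q choose i)) i)"
  have "poly p x = 0" for x
  proof -
    have "x + 1 = (x + 1) ^ ?q" by (simp add: power_CARD)
    also have "\<dots> = (\<Sum>i\<le>?q. of_nat (?q choose i) * x ^ i)"
      by (simp add: binomial_ring)
    also have "{..?q} = insert 0 (insert ?q {1..<?q})"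
      using CARD_field_gt_1 by force
    also have "(\<Sum>i\<in>\<dots>. of_nat (?q choose i) * x ^ i) = 1 + x + poly p x"
      by (simp add: p_def poly_sum poly_monom power_CARD)
    finally show ?thesis by simp
  qed
  moreover have "Polynomial.degree p < ?q"
    unfolding p_def using CARD_field_gt_1[where 'a = 'a]
    by (intro le_less_trans[OF degree_sum_le[where n = "?q - 1"]])
      (auto intro: order_trans[OF Polynomial.degree_monom_le])
  ultimately have "p = 0"
    using card_poly_roots_bound[of p] by fastforce
  moreover have "poly.coeff p k = of_nat (?q choose k)"
    using assms by (simp add: p_def Polynomial.coeff_sum if_distrib sum.delta)
  ultimately show ?thesis by simp
qed

text \<open>All inner binomial coefficients vanish in the base field and hence in its closure, so
  only the two end terms of the expansion survive; iteration gives the \<open>j\<close>-fold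
  Frobenius.\<close>

lemma add_power_CARD:
  fixes x y :: "'a :: {field, finite} alg_closure"
  shows "(x + y) ^ (CARD('a) ^ j) = x ^ (CARD('a) ^ j) + y ^ (CARD('a) ^ j)"
proof (induction j)
  case (Suc j)
  let ?q = "CARD('a)"
  have *: "(a + b) ^ ?q = a ^ ?q + b ^ ?q" for a b :: "'a alg_closure"
  proof -
    have "of_nat (?q choose i) = (0 :: 'a alg_closure)" if "0 < i" "i < ?q" for i
      using CARD_choose_eq_0[OF that] by (metis to_ac_0 to_ac_of_nat)
    then have "(\<Sum>i\<le>?q. of_nat (?q choose i) * a ^ i * b ^ (?q - i))
      = (\<Sum>i\<in>{0, ?q}. of_nat (?q choose i) * a ^ i * b ^ (?q - i))"
      by (intro sum.mono_neutral_right) auto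
    then show ?thesis
      by (simp add: binomial_ring add.commute)
  qed
  show ?case
    by (simp add: power_mult Suc * mult.commute[of ?q])
qed simp

lemma to_ac_power_CARD:
  "to_ac (a :: 'a :: {field, finite}) ^ (CARD('a) ^ j) = to_ac a"
  by (induction j) (simp_all add: power_mult power_CARD mult.commute[of "CARD('a)"] flip: to_ac_power)

lemma sum_power_CARD:
  fixes f :: "'i \<Rightarrow> 'a :: {field, finite} alg_closure"
  shows "(\<Sum>i\<in>I. f i) ^ (CARD('a) ^ j) = (\<Sum>i\<in>I. f i ^ (CARD('a) ^ j))"
  by (induction I rule: infinite_finite_induct) (simp_all add: add_power_CARD zero_power)

text \<open>These are the fixed points of the \<open>d\<close>-fold Frobenius: for positive
  \<open>d\<close>, the field with \<open>q ^ d\<close> elements. As a set inside the closure, it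
  may depend on the value \<open>d\<close>, which a type could not.\<close>

definition galois :: "nat \<Rightarrow> 'a :: {field, finite} alg_closure set" where
  "galois d = {x. x ^ (CARD('a) ^ d) = x}"

lemma to_ac_in_galois: "to_ac a \<in> galois d"
  by (simp add: galois_def to_ac_power_CARD)

lemma galois_mult: "x \<in> galois d \<Longrightarrow> y \<in> galois d \<Longrightarrow> x * y \<in> galois d"
  by (simp add: galois_def power_mult_distrib)

lemma galois_power: "x \<in> galois d \<Longrightarrow> x ^ n \<in> galois d"
  unfolding galois_def mem_Collect_eq by (metis mult.commute power_mult)

lemma galois_add: "x \<in> galois d \<Longrightarrow> y \<in> galois d \<Longrightarrow> x + y \<in> galois d"
  by (simp add: galois_def add_power_CARD)

lemma galois_0: "0 \<in> galois d"
  using to_ac_in_galois[of 0 d] by simp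

lemma galois_sum: "(\<And>i. i \<in> I \<Longrightarrow> f i \<in> galois d) \<Longrightarrow> (\<Sum>i\<in>I. f i) \<in> galois d"
  by (induction I rule: infinite_finite_induct) (simp_all add: galois_add galois_0)

section \<open>Counting the roots of squarefree polynomials\<close>

lemma order_prod_mset_linear:
  "Polynomial.order a (\<Prod>x\<in>#A. [:- x, 1:]) = count A (a :: 'b :: field)"
proof (induction A)
  case (add x A)
  have "(\<Prod>x\<in>#A. [:- x, 1:]) \<noteq> 0" by (auto simp: prod_mset_zero_iff)
  moreover have "Polynomial.order a [:- x, 1:] = (if x = a then 1 else 0)"
    using order_power_n_n[of a 1] by (auto intro: order_0I)
  ultimately show ?case
    using add by (simp add: order_mult del: mult_pCons_left)
qed simp

text \<open>The polynomial splits into linear factors over an algebraically closed field.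
  Squarefreeness makes all multiplicities in the multiset \<open>A\<close> of roots equal to 1, so
  its size is the number of distinct roots.\<close>

lemma card_roots_rsquarefree:
  fixes p :: "'b :: alg_closed_field poly"
  assumes "rsquarefree p"
  shows "card {a. poly p a = 0} = Polynomial.degree p"
proof -
  have p: "p \<noteq> 0" using assms by (simp add: rsquarefree_def)
  then obtain A where A: "size A = Polynomial.degree p"
      "p = Polynomial.smult (Polynomial.lead_coeff p) (\<Prod>x\<in>#A. [:- x, 1:])"
    using alg_closed_imp_factorization by blast
  have order: "Polynomial.order a p = count A a" for a
    using p by (subst A(2)) (simp add: order_smult order_prod_mset_linear)
  have set_A: "set_mset A = {a. poly p a = 0}"
    using p by (auto simp: order_root order not_in_iff)
  have "A = mset_set (set_mset A)"
  proof (rule multiset_eqI)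
    fix a
    have "count A a = 0 \<or> count A a = 1"
      using assms by (simp add: rsquarefree_def order)
    then show "count A a = count (mset_set (set_mset A)) a"
      by (cases "a \<in># A") (auto simp: count_eq_zero_iff)
  qed
  then have "size A = card (set_mset A)" by (metis size_mset_set)
  with A(1) set_A show ?thesis by simp
qed

text \<open>By the product rule, a multiple root would also be a root of the derivative.\<close>

lemma rsquarefree_if_pderiv:
  fixes p :: "'b :: idom poly"
  assumes "p \<noteq> 0" and "\<And>a. poly (pderiv p) a \<noteq> 0"
  shows "rsquarefree p"
proof -
  have "Polynomial.order a p < 2" for a
  proof (rule ccontr)
    assume "\<not> Polynomial.order a p < 2"
    then have "[:- a, 1:] ^ 2 dvd p"
      using assms(1) by (subst order_divides) auto
    then obtain r where "p = [:- a, 1:] * ([:- a, 1:] * r)"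
      unfolding power2_eq_square by (metis dvdE mult.assoc)
    then have "poly (pderiv p) a = 0"
      by (simp add: pderiv_mult del: mult_pCons_left)
    with assms(2) show False by blast
  qed
  then show ?thesis
    using assms(1) by (auto simp: rsquarefree_def less_2_cases_iff)
qed

text \<open>The elements are the roots of \<open>x ^ (q ^ d) - x\<close>, whose derivative is the
  constant -1; so there are as many distinct roots as the degree.\<close>

lemma card_galois:
  assumes "0 < d"
  shows "card (galois d :: 'a :: {field, finite} alg_closure set) = CARD('a) ^ d"
proof -
  let ?q = "CARD('a)"
  have q: "?q ^ d > 1"
    using assms CARD_field_gt_1 by (metis one_less_power)
  define p :: "'a alg_closure poly" where
    "p = Polynomial.monom 1 (?q ^ d) - Polynomial.monom 1 1"
  have roots: "{x. poly p x = 0} = galois d"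
    by (auto simp: p_def galois_def poly_monom)
  have coeff: "poly.coeff p (?q ^ d) = 1"
    using q by (simp add: p_def)
  then have "p \<noteq> 0" by auto
  \<comment> \<open>The number \<open>?q\<close> is itself the binomial coefficient
    \<open>?q choose 1\<close>.\<close>
  have "of_nat ?q = (0 :: 'a)"
    using CARD_choose_eq_0[of 1, where 'a='a] CARD_field_gt_1[where 'a='a] by simp
  then have "of_nat ?q = (0 :: 'a alg_closure)"
    by (metis to_ac_0 to_ac_of_nat)
  then have "pderiv p = - 1"
    using assms by (simp add: p_def pderiv_diff pderiv_monom zero_power)
  then have "rsquarefree p"
    using \<open>p \<noteq> 0\<close> by (intro rsquarefree_if_pderiv) auto
  have deg: "Polynomial.degree p = ?q ^ d"
  proof (rule antisym)
    show "Polynomial.degree p \<le> ?q ^ d"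
      unfolding p_def using q by (intro degree_diff_le Polynomial.degree_monom_le[THEN order_trans]) auto
    show "?q ^ d \<le> Polynomial.degree p"
      using coeff by (intro le_degree) auto
  qed
  show ?thesis
    using card_roots_rsquarefree[OF \<open>rsquarefree p\<close>] by (simp add: roots deg)
qed

section \<open>Subspaces over the small field\<close>

interpretation ac: Vector_Spaces.vector_space "\<lambda>(a :: 'a :: field) x. to_ac a * x"
  by unfold_locales (simp_all add: algebra_simps)

declare ac.scale_scale [simp del] \<comment> \<open>loops with \<open>to_ac_mult\<close>\<close>

text \<open>Coordinates with respect to a basis \<open>B\<close> identify the functions from
  \<open>B\<close> to the scalars with \<open>S\<close>. Extensional functions make this a bijection
  of finite sets.\<close>

lemma (in Vector_Spaces.vector_space) finite_subspace_card:
  fixes S :: "'b set"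
  assumes "finite (UNIV :: 'a set)" "finite S" "subspace S"
  obtains B where "B \<subseteq> S" "independent B" "span B = S" "card S = CARD('a) ^ card B"
proof -
  obtain B where B: "B \<subseteq> S" "independent B" "S \<subseteq> span B"
    using basis_exists[of S] by metis
  have span: "span B = S"
    using B assms by (simp add: span_subspace)
  have fB: "finite B" using B(1) assms by (metis finite_subset)
  have "bij_betw (\<lambda>f. \<Sum>b\<in>B. scale (f b) b) (B \<rightarrow>\<^sub>E UNIV) S"
    unfolding bij_betw_def
  proof
    show "inj_on (\<lambda>f. \<Sum>b\<in>B. scale (f b) b) (B \<rightarrow>\<^sub>E UNIV)"
    proof (rule inj_onI)
      fix f g assume fg: "f \<in> B \<rightarrow>\<^sub>E UNIV" "g \<in> B \<rightarrow>\<^sub>E UNIV"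
        "(\<Sum>b\<in>B. scale (f b) b) = (\<Sum>b\<in>B. scale (g b) b)"
      then have "(\<Sum>b\<in>B. scale (f b - g b) b) = 0"
        by (simp add: scale_left_diff_distrib sum_subtractf)
      then have "f b - g b = 0" if "b \<in> B" for b
        by (rule independentD[OF B(2) fB subset_refl _ that])
      then show "f = g"
        using fg by (intro PiE_ext[of f B "\<lambda>_. UNIV"]) auto
    qed
    show "(\<lambda>f. \<Sum>b\<in>B. scale (f b) b) ` (B \<rightarrow>\<^sub>E UNIV) = S"
    proof -
      have "(\<Sum>b\<in>B. scale (f b) b) \<in> (\<lambda>f. \<Sum>b\<in>B. scale (f b) b) ` (B \<rightarrow>\<^sub>E UNIV)" for f
        by (rule image_eqI[of _ _ "restrict f B"]) auto
      then show ?thesis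
        unfolding span[symmetric] span_finite[OF fB] by auto
    qed
  qed
  then have "card S = card (B \<rightarrow>\<^sub>E (UNIV :: 'a set))"
    by (simp add: bij_betw_same_card)
  with B fB span that show thesis
    by (simp add: card_PiE)
qed

section \<open>Matrix rank and row spaces over finite fields\<close>

lemma card_carrier_vec: "card (carrier_vec n :: 'a :: finite vec set) = CARD('a) ^ n"
proof -
  have "bij_betw list_of_vec (carrier_vec n) {xs :: 'a list. set xs \<subseteq> UNIV \<and> length xs = n}"
    by (rule bij_betw_byWitness[of _ vec_of_list]) (auto simp: vec_list list_vec intro: carrier_vecI)
  then have "card (carrier_vec n :: 'a vec set) = card {xs :: 'a list. set xs \<subseteq> UNIV \<and> length xs = n}"
    by (rule bij_betw_same_card)
  then show ?thesis
    by (simp only: card_lists_length_eq[OF finite])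
qed

lemma finite_carrier_vec: "finite (carrier_vec n :: 'a :: finite vec set)"
  by (rule card_ge_0_finite) (simp add: card_carrier_vec)

text \<open>The columns of \<open>B\<close> are a maximal independent set of columns of
  \<open>A\<close>, and \<open>C\<close> expresses every column of \<open>A\<close> through them.
  This serves to compare the images of \<open>A\<close> and its transpose.\<close>

lemma (in vec_space) rank_factorization:
  assumes A: "A \<in> carrier_mat n nc"
  obtains B C where "B \<in> carrier_mat n (rank A)" "C \<in> carrier_mat (rank A) nc" "A = B * C"
    "inj_on ((*\<^sub>v) B) (carrier_vec (rank A))" "(*\<^sub>v) A ` carrier_vec nc = (*\<^sub>v) B ` carrier_vec (rank A)"
proof -
  have colsA: "set (cols A) \<subseteq> carrier_vec n" using A cols_dim by blast
  obtain S where S: "finite S" "maximal S (\<lambda>T. T \<subseteq> set (cols A) \<and> lin_indpt T)"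
    using maximal_exists_superset[of "set (cols A)" "\<lambda>T. T \<subseteq> set (cols A) \<and> lin_indpt T" "{}"]
    by (auto simp: lin_dep_def)
  then have SA: "S \<subseteq> set (cols A)" and indpt: "lin_indpt S"
    by (auto simp: maximal_def)
  have card: "card S = rank A"
    using rank_card_indpt[OF A S(2)] by simp
  obtain bs where bs: "set bs = S" "distinct bs"
    using finite_distinct_list[OF S(1)] by blast
  then have len: "length bs = rank A"
    using card by (metis distinct_card)
  define B where "B = mat_of_cols n bs"
  have B: "B \<in> carrier_mat n (rank A)"
    by (auto simp: B_def len)
  have cols_B: "cols B = bs"
    unfolding B_def using SA colsA bs by (intro cols_mat_of_cols) auto
  have "span S = span (set (cols A))"
  proof (rule antisym)
    show "span S \<subseteq> span (set (cols A))"
      using SA by (rule span_is_monotone)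
    \<comment> \<open>A column outside \<open>span S\<close> could be added to \<open>S\<close>
      without losing independence, against maximality.\<close>
    have "v \<in> span S" if v: "v \<in> set (cols A)" for v
    proof (rule ccontr)
      assume "v \<notin> span S"
      then have "lin_indpt (insert v S)" "v \<notin> S"
        using lin_dep_iff_in_span[of S v] span_mem[of S v] SA colsA v indpt by auto
      then show False
        using S(2) v SA by (auto simp: maximal_def)
    qed
    then show "span (set (cols A)) \<subseteq> span S"
      using SA colsA by (intro span_is_subset span_is_submodule) auto
  qed
  then have col_space: "col_space B = col_space A"
    unfolding col_space_def cols_B bs(1) .
  have img: "(*\<^sub>v) A ` carrier_vec nc = (*\<^sub>v) B ` carrier_vec (rank A)"
    using col_space A B unfolding col_space_eq[OF A] col_space_eq[OF B]
    by (auto simp: set_eq_iff image_iff) (metis mult_mat_vec_carrier)+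
  have "\<exists>x\<in>carrier_vec (rank A). col A j = B *\<^sub>v x" if "j < nc" for j
  proof -
    \<comment> \<open>Column \<open>j\<close> thus lies in the image of \<open>A\<close>, which is
      that of \<open>B\<close>; its preimage under \<open>B\<close> becomes column \<open>j\<close>
      of \<open>C\<close>.\<close>
    have "col A j = A *\<^sub>v unit_vec nc j"
      using A that by auto
    then show ?thesis
      using img that by (metis imageE imageI unit_vec_carrier)
  qed
  then obtain c where c: "\<And>j. j < nc \<Longrightarrow> c j \<in> carrier_vec (rank A) \<and> col A j = B *\<^sub>v c j"
    by metis
  define C where "C = mat_of_cols (rank A) (map c [0..<nc])"
  have C: "C \<in> carrier_mat (rank A) nc"
    by (auto simp: C_def)
  have "A = B * C"
  proof (rule mat_col_eqI)
    fix j assume "j < dim_col (B * C)"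
    then have j: "j < nc" using C by simp
    have "col C j = c j"
      using j c by (simp add: C_def)
    then show "col A j = col (B * C) j"
      using c[OF j] j B C by (simp only: col_mult2)
  qed (use A B C in auto)
  moreover have "inj_on ((*\<^sub>v) B) (carrier_vec (rank A))"
  proof (rule inj_onI)
    fix x y assume xy: "x \<in> carrier_vec (rank A)" "y \<in> carrier_vec (rank A)" "B *\<^sub>v x = B *\<^sub>v y"
    then have "B *\<^sub>v (x - y) = 0\<^sub>v n"
      using B by (simp add: mult_minus_distrib_mat_vec)
    then have "x - y = 0\<^sub>v (rank A)"
      using lin_depI[OF B, of "x - y"] indpt xy bs cols_B by auto
    then show "x = y"
      using xy by (auto simp: vec_eq_iff)
  qed
  ultimately show thesis
    using that B C img by blast
qed

text \<open>With \<open>A = B * C\<close> from the rank factorization, \<open>B\<close> maps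
  \<open>q ^ rank\<close> vectors injectively onto the image of \<open>A\<close>. The transpose
  factors through the transpose of \<open>C\<close>, whose domain has the same size, so its image is
  no larger.\<close>

lemma
  fixes A :: "'a :: {field, finite} mat"
  assumes A: "A \<in> carrier_mat n nc"
  shows card_mat_image: "card ((*\<^sub>v) A ` carrier_vec nc) = CARD('a) ^ vec_space.rank n A"
    and card_transpose_image_le: "card ((*\<^sub>v) A\<^sup>T ` carrier_vec n) \<le> card ((*\<^sub>v) A ` carrier_vec nc)"
proof -
  let ?r = "vec_space.rank n A"
  obtain B C where BC: "B \<in> carrier_mat n ?r" "C \<in> carrier_mat ?r nc" "A = B * C"
    "inj_on ((*\<^sub>v) B) (carrier_vec ?r)" "(*\<^sub>v) A ` carrier_vec nc = (*\<^sub>v) B ` carrier_vec ?r"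
    using vec_space.rank_factorization[OF A] by blast
  show *: "card ((*\<^sub>v) A ` carrier_vec nc) = CARD('a) ^ ?r"
    by (simp add: BC(5) card_image BC(4) card_carrier_vec)
  have "(*\<^sub>v) A\<^sup>T ` carrier_vec n \<subseteq> (*\<^sub>v) C\<^sup>T ` carrier_vec ?r"
  proof (rule image_subsetI)
    fix x :: "'a vec" assume x: "x \<in> carrier_vec n"
    have "A\<^sup>T *\<^sub>v x = C\<^sup>T *\<^sub>v (B\<^sup>T *\<^sub>v x)"
      using BC x by (simp add: transpose_mult[OF BC(1,2)])
    then show "A\<^sup>T *\<^sub>v x \<in> (*\<^sub>v) C\<^sup>T ` carrier_vec ?r"
      using BC(1) x by auto
  qed
  then have "card ((*\<^sub>v) A\<^sup>T ` carrier_vec n) \<le> card ((*\<^sub>v) C\<^sup>T ` carrier_vec ?r)"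
    by (intro card_mono finite_imageI finite_carrier_vec)
  also have "\<dots> \<le> CARD('a) ^ ?r"
    by (metis card_image_le card_carrier_vec finite_carrier_vec)
  finally show "card ((*\<^sub>v) A\<^sup>T ` carrier_vec n) \<le> card ((*\<^sub>v) A ` carrier_vec nc)"
    using * by simp
qed

text \<open>Row rank equals column rank: the previous inequality is applied to \<open>A\<close> and
  to its transpose.\<close>

lemma card_row_space:
  fixes A :: "'a :: {field, finite} mat"
  assumes A: "A \<in> carrier_mat n nc"
  shows "card ((*\<^sub>v) A\<^sup>T ` carrier_vec n) = CARD('a) ^ vec_space.rank n A"
proof (rule antisym)
  show "card ((*\<^sub>v) A\<^sup>T ` carrier_vec n) \<le> CARD('a) ^ vec_space.rank n A"
    using card_transpose_image_le[OF A] card_mat_image[OF A] by simp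
  have "A\<^sup>T \<in> carrier_mat nc n" using A by simp
  from card_transpose_image_le[OF this]
  show "CARD('a) ^ vec_space.rank n A \<le> card ((*\<^sub>v) A\<^sup>T ` carrier_vec n)"
    using card_mat_image[OF A] by simp
qed

text \<open>A partial identity with \<open>r\<close> ones serves, its rank being read off the size
  of its image. Such matrices make the sets of channels nonempty, as a maximum over the empty set is
  unspecified.\<close>

lemma exists_mat_rank:
  assumes "r \<le> n" "r \<le> nc"
  shows "\<exists>A :: 'a :: {field, finite} mat. A \<in> carrier_mat n nc \<and> vec_space.rank n A = r"
proof -
  define A :: "'a mat" where "A = mat n nc (\<lambda>(i, j). if i = j \<and> i < r then 1 else 0)"
  have A: "A \<in> carrier_mat n nc" by (simp add: A_def)
  define e :: "'a vec \<Rightarrow> 'a vec" where "e v = vec n (\<lambda>i. if i < r then v $ i else 0)" for v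
  have Av: "A *\<^sub>v v = e v" if "v \<in> carrier_vec nc" for v
  proof (rule eq_vecI)
    fix i assume "i < dim_vec (e v)"
    then have i: "i < n" by (simp add: e_def)
    have "(A *\<^sub>v v) $ i = (\<Sum>j<nc. (if i = j \<and> i < r then 1 else 0) * v $ j)"
      using i that by (simp add: A_def scalar_prod_def atLeast0LessThan)
    also have "\<dots> = (\<Sum>j<nc. if j = i then (if i < r then v $ i else 0) else 0)"
      by (intro sum.cong) auto
    also have "\<dots> = e v $ i"
      using i assms by (auto simp: e_def)
    finally show "(A *\<^sub>v v) $ i = e v $ i" .
  qed (simp add: A_def e_def)
  have "(*\<^sub>v) A ` carrier_vec nc = e ` carrier_vec nc"
    using Av by auto
  also have "\<dots> = e ` carrier_vec r"
  proof -
    have "e v \<in> e ` carrier_vec r" if "v \<in> carrier_vec nc" for v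
      by (rule image_eqI[of _ _ "vec r (\<lambda>i. v $ i)"]) (auto simp: e_def)
    moreover have "e v \<in> e ` carrier_vec nc" if "v \<in> carrier_vec r" for v
      by (rule image_eqI[of _ _ "vec nc (\<lambda>i. if i < r then v $ i else 0)"]) (use assms in \<open>auto simp: e_def\<close>)
    ultimately show ?thesis by blast
  qed
  also have "card \<dots> = CARD('a) ^ r"
  proof -
    have "inj_on e (carrier_vec r)"
    proof (rule inj_onI)
      fix v w :: "'a vec"
      assume vw: "v \<in> carrier_vec r" "w \<in> carrier_vec r" "e v = e w"
      show "v = w"
      proof (rule eq_vecI)
        fix i assume "i < dim_vec w"
        with vw have "i < r" by simp
        with fun_cong[OF arg_cong[OF vw(3), of vec_index], of i] assms show "v $ i = w $ i"
          by (simp add: e_def)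
      qed (use vw in auto)
    qed
    then show ?thesis by (simp add: card_image card_carrier_vec)
  qed
  finally have "CARD('a) ^ vec_space.rank n A = CARD('a) ^ r"
    using card_mat_image[OF A] by simp
  then show ?thesis
    using A CARD_field_gt_1[where 'a='a] by (auto simp: power_inject_exp)
qed

section \<open>Linearized polynomials\<close>


definition lin_poly ::
  "nat \<Rightarrow> (nat \<Rightarrow> 'a alg_closure) \<Rightarrow> 'a :: {field, finite} alg_closure \<Rightarrow> 'a alg_closure" where
  "lin_poly m u x = (\<Sum>j<m. u j * x ^ (CARD('a) ^ j))"

text \<open>Frobenius powers are additive and fix the small field, so linearized polynomials are
  linear over it.\<close>

lemma lin_poly_sum:
  fixes x :: "'i \<Rightarrow> 'a :: {field, finite} alg_closure"
  shows "lin_poly m u (\<Sum>i\<in>I. to_ac (c i) * x i) = (\<Sum>i\<in>I. to_ac (c i) * lin_poly m u (x i))"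
proof -
  have "lin_poly m u (\<Sum>i\<in>I. to_ac (c i) * x i)
    = (\<Sum>j<m. \<Sum>i\<in>I. to_ac (c i) * (u j * x i ^ (CARD('a) ^ j)))"
    by (simp add: lin_poly_def sum_power_CARD power_mult_distrib to_ac_power_CARD sum_distrib_left
        mult.left_commute)
  also have "\<dots> = (\<Sum>i\<in>I. to_ac (c i) * lin_poly m u (x i))"
    by (subst sum.swap) (simp add: lin_poly_def sum_distrib_left)
  finally show ?thesis .
qed

lemma lin_poly_in_galois:
  "u \<in> {..<m} \<rightarrow> galois d \<Longrightarrow> x \<in> galois d \<Longrightarrow> lin_poly m u x \<in> galois d"
  unfolding lin_poly_def by (intro galois_sum galois_mult galois_power) auto

text \<open>The difference of the two is an ordinary polynomial of degree at most
  \<open>q ^ (m - 1)\<close> with at least \<open>q ^ m\<close> roots, so it is zero. The exponents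
  \<open>q ^ j\<close> are distinct, so its coefficients are the differences
  \<open>u j - v j\<close>.\<close>

lemma lin_poly_coeffs_unique:
  fixes W :: "'a :: {field, finite} alg_closure set"
  assumes eq: "\<And>x. x \<in> W \<Longrightarrow> lin_poly m u x = lin_poly m v x"
    and card: "CARD('a) ^ m \<le> card W" and j: "j < m"
  shows "u j = v j"
proof -
  let ?q = "CARD('a)"
  define p where "p = (\<Sum>j<m. Polynomial.monom (u j - v j) (?q ^ j))"
  have poly_p: "poly p x = lin_poly m u x - lin_poly m v x" for x
    by (simp add: p_def lin_poly_def poly_sum poly_monom algebra_simps sum_subtractf)
  have "p = 0"
  proof (rule ccontr)
    assume "p \<noteq> 0"
    then have "finite {x. poly p x = 0}"
      by (rule poly_roots_finite)
    moreover have "W \<subseteq> {x. poly p x = 0}"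
      using eq by (auto simp: poly_p)
    ultimately have "card W \<le> card {x. poly p x = 0}"
      by (rule card_mono)
    also have "\<dots> \<le> Polynomial.degree p"
      by (rule card_poly_roots_bound) fact
    also have "\<dots> \<le> ?q ^ (m - 1)"
      unfolding p_def using CARD_field_gt_1[where 'a = 'a]
      by (intro degree_sum_le) (auto intro!: order_trans[OF Polynomial.degree_monom_le] power_increasing)
    also have "\<dots> < ?q ^ m"
      using CARD_field_gt_1[where 'a = 'a] j by (intro power_strict_increasing) auto
    finally show False using card by simp
  qed
  moreover have "poly.coeff p (?q ^ j) = u j - v j"
    unfolding p_def using CARD_field_gt_1[where 'a = 'a] j
    by (simp add: Polynomial.coeff_sum power_inject_exp if_distrib sum.delta cong: if_cong)
  ultimately show ?thesis by simp
qed

section \<open>A basis of the extension field, and rerandomization on a subspace\<close>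

lemma finite_galois: "0 < d \<Longrightarrow> finite (galois d :: 'a :: {field, finite} alg_closure set)"
  by (rule card_ge_0_finite) (simp add: card_galois)

lemma subspace_galois: "ac.subspace (galois d :: 'a :: {field, finite} alg_closure set)"
  unfolding ac.subspace_def by (intro conjI allI ballI impI galois_0 galois_add galois_mult to_ac_in_galois)

lemma galois_basis:
  assumes "0 < d"
  obtains g :: "nat \<Rightarrow> 'a :: {field, finite} alg_closure"
  where "\<And>i. i < d \<Longrightarrow> g i \<in> galois d"
    "bij_betw (\<lambda>v. \<Sum>i<d. to_ac (v $ i) * g i) (carrier_vec d) (galois d)"
proof -
  obtain B :: "'a alg_closure set" where B: "B \<subseteq> galois d" "ac.independent B" "ac.span B = galois d"
    "card (galois d :: 'a alg_closure set) = CARD('a) ^ card B"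
    by (rule ac.finite_subspace_card[OF finite finite_galois[OF assms] subspace_galois])
  have "card B = d"
    using B(4) assms CARD_field_gt_1[where 'a = 'a] by (simp add: card_galois power_inject_exp)
  have fin: "finite B" using B(1) finite_galois[OF assms] by (rule finite_subset)
  obtain g where g: "bij_betw g {..<d} B"
    using ex_bij_betw_nat_finite[OF fin] \<open>card B = d\<close> by (auto simp: atLeast0LessThan)
  let ?f = "\<lambda>v. \<Sum>i<d. to_ac (v $ i) * g i"
  have "?f ` carrier_vec d = galois d"
  proof -
    have "(\<Sum>b\<in>B. to_ac (c b) * b) \<in> ?f ` carrier_vec d" for c
      by (rule image_eqI[of _ _ "vec d (\<lambda>i. c (g i))"])
        (auto simp flip: sum.reindex_bij_betw[OF g])
    moreover have "?f v \<in> galois d" for v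
      using g B(1) by (intro galois_sum galois_mult to_ac_in_galois) (auto simp: bij_betw_def)
    ultimately show ?thesis
      using ac.span_finite[OF fin] B(3) by auto
  qed
  \<comment> \<open>A surjection between finite sets of the same size \<open>q ^ d\<close> is
    injective.\<close>
  moreover from this have "inj_on ?f (carrier_vec d)"
    using assms by (intro eq_card_imp_inj_on finite_carrier_vec) (simp add: card_galois card_carrier_vec)
  moreover have "g i \<in> galois d" if "i < d" for i
    using g B(1) that by (auto simp: bij_betw_def)
  ultimately show thesis
    by (intro that[of g]) (auto simp: bij_betw_def)
qed

text \<open>Here \<open>r\<close> is the scramble part and \<open>s\<close> the message part. The
  scramble part takes the low positions so that two polynomials with the same message differ by one
  of low degree.\<close>

definition join_coeffs :: "nat \<Rightarrow> (nat \<Rightarrow> 'b) \<Rightarrow> (nat \<Rightarrow> 'b) \<Rightarrow> nat \<Rightarrow> 'b" where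
  "join_coeffs m r s j = (if j < m then r j else s j)"

lemma lin_poly_join:
  fixes x :: "'a :: {field, finite} alg_closure"
  assumes "m \<le> n"
  shows "lin_poly n (join_coeffs m r s) x
    = lin_poly m r x + (\<Sum>j\<in>{m..<n}. s j * x ^ (CARD('a) ^ j))"
proof -
  have "{..<n} = {..<m} \<union> {m..<n}" using assms by auto
  then show ?thesis
    by (simp add: lin_poly_def join_coeffs_def sum.union_disjoint ivl_disj_int)
qed

text \<open>For a fixed message part, the map \<open>T s\<close> from scramble parts to values on a
  basis of \<open>W\<close> is injective by the root count, and both sides have
  \<open>(q ^ d) ^ m\<close> elements. So it is bijective, and \<open>h\<close> is
  \<open>T s\<close> followed by the inverse of \<open>T s'\<close>.\<close>

lemma lin_poly_rerandomize:
  fixes W :: "'a :: {field, finite} alg_closure set"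
  assumes d: "0 < d" and W: "ac.subspace W" "W \<subseteq> galois d" "card W = CARD('a) ^ m" and m: "m \<le> n"
    and s: "s \<in> {m..<n} \<rightarrow> galois d" "s' \<in> {m..<n} \<rightarrow> galois d"
  obtains h where "bij_betw h ({..<m} \<rightarrow>\<^sub>E galois d) ({..<m} \<rightarrow>\<^sub>E galois d)"
    "\<And>r x. r \<in> {..<m} \<rightarrow>\<^sub>E galois d \<Longrightarrow> x \<in> W \<Longrightarrow>
      lin_poly n (join_coeffs m r s) x = lin_poly n (join_coeffs m (h r) s') x"
proof -
  let ?R = "{..<m} \<rightarrow>\<^sub>E (galois d :: 'a alg_closure set)"
  have finW: "finite W" using W(2) finite_galois[OF d] by (rule finite_subset)
  obtain B where B: "B \<subseteq> W" "ac.independent B" "ac.span B = W" "card W = CARD('a) ^ card B"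
    by (rule ac.finite_subspace_card[OF finite finW W(1)])
  then have "card B = m"
    using W(3) CARD_field_gt_1[where 'a = 'a] by (simp add: power_inject_exp)
  have fin: "finite B" using B(1) finW by (rule finite_subset)
  have span_eq: "lin_poly n u x = lin_poly n v x"
    if "\<And>b. b \<in> B \<Longrightarrow> lin_poly n u b = lin_poly n v b" "x \<in> W" for u v x
    using that B(3) ac.span_finite[OF fin] by (auto simp: lin_poly_sum)
  define T where "T s r = restrict (lin_poly n (join_coeffs m r s)) B" for s r
  have bij: "bij_betw (T s) ?R (B \<rightarrow>\<^sub>E galois d)"
    if s: "s \<in> {m..<n} \<rightarrow> galois d" for s
  proof -
    have maps: "T s ` ?R \<subseteq> B \<rightarrow>\<^sub>E galois d"
      using subset_trans[OF B(1) W(2)] s unfolding T_def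
      by (auto intro!: lin_poly_in_galois simp: join_coeffs_def PiE_iff Pi_iff subset_iff)
    have inj: "inj_on (T s) ?R"
    proof (rule inj_onI)
      fix r r' assume r: "r \<in> ?R" "r' \<in> ?R" and eq: "T s r = T s r'"
      have "lin_poly n (join_coeffs m r s) b = lin_poly n (join_coeffs m r' s) b" if "b \<in> B" for b
        using fun_cong[OF eq, of b] that by (simp add: T_def)
      \<comment> \<open>The two polynomials share \<open>s\<close>, so the terms from
        \<open>m\<close> on cancel and \<open>q ^ m\<close> points suffice to compare the
        rest.\<close>
      from span_eq[OF this] have "lin_poly m r x = lin_poly m r' x" if "x \<in> W" for x
        using that by (simp add: lin_poly_join[OF m])
      then have "r j = r' j" if "j < m" for j
        using lin_poly_coeffs_unique[of W m r r' j] W(3) that by simp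
      then show "r = r'"
        using r by (intro PiE_ext[of r "{..<m}" "\<lambda>_. galois d"]) auto
    qed
    have "card ?R = card (B \<rightarrow>\<^sub>E (galois d :: 'a alg_closure set))"
      using fin \<open>card B = m\<close> by (simp add: card_PiE)
    then have "T s ` ?R = B \<rightarrow>\<^sub>E galois d"
      using maps inj fin finite_galois[OF d]
      by (intro card_subset_eq finite_PiE) (auto simp: card_image)
    with inj show ?thesis by (simp add: bij_betw_def)
  qed
  define h where "h = inv_into ?R (T s') \<circ> T s"
  show thesis
  proof
    show "bij_betw h ?R ?R"
      unfolding h_def using bij_betw_trans[OF bij[OF s(1)] bij_betw_inv_into[OF bij[OF s(2)]]] by blast
    fix r x assume r: "r \<in> ?R" and x: "x \<in> W"
    have "T s' (h r) = T s r"
      unfolding h_def o_def using r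
      by (intro bij_betw_inv_into_right[OF bij[OF s(2)]] bij_betw_apply[OF bij[OF s(1)]])
    then have "lin_poly n (join_coeffs m (h r) s') b = lin_poly n (join_coeffs m r s) b" if "b \<in> B" for b
      using that by (metis T_def restrict_apply)
    from span_eq[OF this x]
    show "lin_poly n (join_coeffs m r s) x = lin_poly n (join_coeffs m (h r) s') x" by simp
  qed
qed

section \<open>Gabidulin codes with a header\<close>

text \<open>A codeword comes from \<open>n\<close> coefficients and \<open>N\<close> evaluation
  points. The bound \<open>N \<le> d\<close> lets these points be part of a basis, hence
  independent; the whole basis gives the coordinates that bring values back to the small
  field.\<close>

locale gabidulin =
  fixes d n N :: nat and g :: "nat \<Rightarrow> 'a :: {field, finite} alg_closure"
  assumes d: "0 < d" "N \<le> d"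
    and g: "\<And>i. i < d \<Longrightarrow> g i \<in> galois d"
    and basis: "bij_betw (\<lambda>v. \<Sum>i<d. to_ac (v $ i) * g i) (carrier_vec d) (galois d)"
begin

definition comb :: "'a vec \<Rightarrow> 'a alg_closure" where
  "comb v = (\<Sum>i<d. to_ac (v $ i) * g i)"

definition coord :: "'a alg_closure \<Rightarrow> 'a vec" where
  "coord = inv_into (carrier_vec d) comb"

lemma bij_comb: "bij_betw comb (carrier_vec d) (galois d)"
  using basis by (simp add: comb_def[abs_def])

lemma coord_in_carrier: "x \<in> galois d \<Longrightarrow> coord x \<in> carrier_vec d"
  unfolding coord_def by (rule bij_betw_apply[OF bij_betw_inv_into[OF bij_comb]])

lemma comb_coord: "x \<in> galois d \<Longrightarrow> comb (coord x) = x"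
  unfolding coord_def by (rule bij_betw_inv_into_right[OF bij_comb])

lemma coord_comb: "v \<in> carrier_vec d \<Longrightarrow> coord (comb v) = v"
  unfolding coord_def by (rule bij_betw_inv_into_left[OF bij_comb])

lemma coord_eq_iff: "x \<in> galois d \<Longrightarrow> y \<in> galois d \<Longrightarrow> coord x = coord y \<longleftrightarrow> x = y"
  by (metis comb_coord)

text \<open>
  The identity header reveals \<open>K\<close> to the receiver of \<open>K * codeword u\<close>; row \<open>i\<close> of the payload
  holds the coordinates of the value of the linearized polynomial \<open>u\<close> at \<open>g i\<close>.
\<close>

definition codeword :: "(nat \<Rightarrow> 'a alg_closure) \<Rightarrow> 'a mat" where
  "codeword u = mat N (N + d) (\<lambda>(i, c).
     if c < N then if i = c then 1 else 0 else coord (lin_poly n u (g i)) $ (c - N))"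

definition point :: "'a mat \<Rightarrow> nat \<Rightarrow> 'a alg_closure" where
  "point K a = (\<Sum>i<N. to_ac (K $$ (a, i)) * g i)"

lemma codeword_carrier: "codeword u \<in> carrier_mat N (N + d)"
  by (simp add: codeword_def)

lemma point_in_galois: "point K a \<in> galois d"
  unfolding point_def using d g by (intro galois_sum galois_mult to_ac_in_galois) auto

lemma mult_codeword_header:
  assumes "K \<in> carrier_mat r N" "a < r" "c < N"
  shows "(K * codeword u) $$ (a, c) = K $$ (a, c)"
proof -
  have "(K * codeword u) $$ (a, c) = (\<Sum>i<N. K $$ (a, i) * (if i = c then 1 else 0))"
    using assms by (simp add: codeword_def scalar_prod_def atLeast0LessThan)
  also have "\<dots> = K $$ (a, c)"
    using assms by (simp add: if_distrib sum.delta cong: if_cong)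
  finally show ?thesis .
qed

text \<open>Both \<open>comb\<close> and the linearized polynomial are linear over the small field.
  So combining the coordinates of the values at the \<open>g i\<close> with row \<open>a\<close> of
  \<open>K\<close> gives the coordinates of the value at \<open>point K a\<close>.\<close>

lemma mult_codeword_payload:
  assumes K: "K \<in> carrier_mat r N" "a < r" and c: "c < d"
    and u: "u \<in> {..<n} \<rightarrow> galois d"
  shows "(K * codeword u) $$ (a, N + c) = coord (lin_poly n u (point K a)) $ c"
proof -
  let ?f = "\<lambda>i. lin_poly n u (g i)"
  have f: "?f i \<in> galois d" if "i < N" for i
    using that d g u by (intro lin_poly_in_galois) auto
  define y where "y = vec d (\<lambda>c. \<Sum>i<N. K $$ (a, i) * coord (?f i) $ c)"
  have "comb y = (\<Sum>k<d. \<Sum>i<N. to_ac (K $$ (a, i)) * (to_ac (coord (?f i) $ k) * g k))"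
    by (simp add: comb_def y_def to_ac_sum sum_distrib_right mult.assoc)
  also have "\<dots> = (\<Sum>i<N. to_ac (K $$ (a, i)) * comb (coord (?f i)))"
    by (subst sum.swap) (simp add: comb_def sum_distrib_left)
  also have "\<dots> = lin_poly n u (point K a)"
    using f by (simp add: comb_coord point_def lin_poly_sum)
  finally have "coord (lin_poly n u (point K a)) = y"
    using coord_comb[of y] by (simp add: y_def)
  moreover have "(K * codeword u) $$ (a, N + c) = (\<Sum>i<N. K $$ (a, i) * coord (?f i) $ c)"
    using K c by (simp add: codeword_def scalar_prod_def atLeast0LessThan)
  ultimately show ?thesis
    using c by (simp add: y_def)
qed

text \<open>The header part of the product is \<open>K\<close> itself, and the payload part encodes
  the values at its points. The forward direction serves decoding, the backward one secrecy.\<close>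

lemma mult_codeword_eq_iff:
  assumes K: "K \<in> carrier_mat r N" and K': "K' \<in> carrier_mat r N"
    and u: "u \<in> {..<n} \<rightarrow> galois d" and v: "v \<in> {..<n} \<rightarrow> galois d"
  shows "K * codeword u = K' * codeword v \<longleftrightarrow>
    K = K' \<and> (\<forall>a<r. lin_poly n u (point K a) = lin_poly n v (point K a))"
proof
  assume eq: "K * codeword u = K' * codeword v"
  have "K = K'"
  proof (rule eq_matI)
    fix a c assume "a < dim_row K'" "c < dim_col K'"
    then show "K $$ (a, c) = K' $$ (a, c)"
      using mult_codeword_header[of _ r a c] eq K K' by (metis carrier_matD)
  qed (use K K' in auto)
  moreover have "lin_poly n u (point K a) = lin_poly n v (point K a)" if "a < r" for a
  proof -
    have "coord (lin_poly n u (point K a)) = coord (lin_poly n v (point K a))"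
    proof (rule eq_vecI)
      have dims: "dim_vec (coord (lin_poly n w (point K a))) = d" if "w \<in> {..<n} \<rightarrow> galois d" for w
        using coord_in_carrier[OF lin_poly_in_galois[OF that point_in_galois]] by simp
      then show "dim_vec (coord (lin_poly n u (point K a))) = dim_vec (coord (lin_poly n v (point K a)))"
        using u v by simp
      fix c assume "c < dim_vec (coord (lin_poly n v (point K a)))"
      then have "c < d" using dims v by simp
      then show "coord (lin_poly n u (point K a)) $ c = coord (lin_poly n v (point K a)) $ c"
        using mult_codeword_payload[OF K that _ u, of c] mult_codeword_payload[OF K that _ v, of c]
          eq unfolding \<open>K = K'\<close> by simp
    qed
    then show ?thesis
      using lin_poly_in_galois[OF _ point_in_galois] u v by (simp add: coord_eq_iff)
  qed
  ultimately show "K = K' \<and> (\<forall>a<r. lin_poly n u (point K a) = lin_poly n v (point K a))"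
    by blast
next
  assume asm: "K = K' \<and> (\<forall>a<r. lin_poly n u (point K a) = lin_poly n v (point K a))"
  show "K * codeword u = K' * codeword v"
  proof (rule eq_matI)
    fix a c assume ac: "a < dim_row (K' * codeword v)" "c < dim_col (K' * codeword v)"
    then have a: "a < r" using K' by simp
    show "(K * codeword u) $$ (a, c) = (K' * codeword v) $$ (a, c)"
    proof (cases "c < N")
      case True
      then show ?thesis
        using asm mult_codeword_header[OF K a True] by metis
    next
      case False
      then obtain e where e: "c = N + e" "e < d"
        using ac codeword_carrier[of v] by (auto simp: not_less le_iff_add)
      show ?thesis
        using asm a mult_codeword_payload[OF K a e(2) u] mult_codeword_payload[OF K a e(2) v]
        by (auto simp: e(1))
    qed
  qed (use K K' codeword_carrier[of u] codeword_carrier[of v] in auto)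
qed

section \<open>The subspace of evaluation points belonging to a matrix\<close>

definition row_points :: "'a mat \<Rightarrow> 'a alg_closure set" where
  "row_points K = (\<lambda>v. \<Sum>i<N. to_ac (v $ i) * g i) ` ((*\<^sub>v) K\<^sup>T ` carrier_vec (dim_row K))"

text \<open>Exchanging two sums turns the image of the row space into the span of the points. The
  first form gives the size, the second the subspace property and the extension of values from the
  points by linearity.\<close>

lemma row_points_eq:
  assumes K: "K \<in> carrier_mat r N"
  shows "row_points K = range (\<lambda>c. \<Sum>a<r. to_ac (c a) * point K a)"
proof -
  have *: "(\<Sum>i<N. to_ac ((K\<^sup>T *\<^sub>v y) $ i) * g i) = (\<Sum>a<r. to_ac (y $ a) * point K a)"
    if y: "y \<in> carrier_vec r" for y
  proof -
    have "(\<Sum>i<N. to_ac ((K\<^sup>T *\<^sub>v y) $ i) * g i)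
      = (\<Sum>i<N. \<Sum>a<r. to_ac (y $ a) * (to_ac (K $$ (a, i)) * g i))"
      using K y by (simp add: scalar_prod_def atLeast0LessThan to_ac_sum sum_distrib_left sum_distrib_right mult_ac)
    also have "\<dots> = (\<Sum>a<r. to_ac (y $ a) * point K a)"
      by (subst sum.swap) (simp add: point_def sum_distrib_left)
    finally show ?thesis .
  qed
  show ?thesis
  proof
    show "row_points K \<subseteq> range (\<lambda>c. \<Sum>a<r. to_ac (c a) * point K a)"
      using K by (auto simp: row_points_def *)
    show "range (\<lambda>c. \<Sum>a<r. to_ac (c a) * point K a) \<subseteq> row_points K"
    proof (rule image_subsetI)
      fix c :: "nat \<Rightarrow> 'a"
      have "(\<Sum>a<r. to_ac (c a) * point K a)
        = (\<Sum>i<N. to_ac ((K\<^sup>T *\<^sub>v vec r c) $ i) * g i)"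
        by (subst *) auto
      then show "(\<Sum>a<r. to_ac (c a) * point K a) \<in> row_points K"
        using K unfolding row_points_def image_image by (intro image_eqI[of _ _ "vec r c"]) auto
    qed
  qed
qed

lemma point_in_row_points:
  assumes "K \<in> carrier_mat r N" "a < r"
  shows "point K a \<in> row_points K"
proof -
  have "point K a = (\<Sum>b<r. to_ac (if b = a then 1 else 0) * point K b)"
    using assms by (simp add: if_distrib if_distribR sum.delta cong: if_cong)
  then show ?thesis
    unfolding row_points_eq[OF assms(1)] by (rule image_eqI[of _ _ "\<lambda>b. if b = a then 1 else 0"]) simp
qed

lemma subspace_row_points:
  assumes "K \<in> carrier_mat r N"
  shows "ac.subspace (row_points K)"
  unfolding row_points_eq[OF assms] ac.subspace_def
proof (intro conjI ballI allI)
  let ?f = "\<lambda>c. \<Sum>a<r. to_ac (c a) * point K a"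
  show "0 \<in> range ?f"
    by (rule image_eqI[of _ _ "\<lambda>_. 0"]) auto
  fix x y assume "x \<in> range ?f" "y \<in> range ?f"
  then obtain c e where "x = ?f c" "y = ?f e" by blast
  then show "x + y \<in> range ?f"
    by (intro image_eqI[of _ _ "\<lambda>a. c a + e a"]) (auto simp: distrib_right sum.distrib)
next
  let ?f = "\<lambda>c. \<Sum>a<r. to_ac (c a) * point K a"
  fix b x assume "x \<in> range ?f"
  then obtain c where "x = ?f c" by blast
  then show "to_ac b * x \<in> range ?f"
    by (intro image_eqI[of _ _ "\<lambda>a. b * c a"]) (auto simp: sum_distrib_left mult.assoc)
qed

lemma row_points_subset_galois: "row_points K \<subseteq> galois d"
  unfolding row_points_def using d g by (auto intro!: galois_sum galois_mult to_ac_in_galois)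

text \<open>Padding a vector with zeros to length \<open>d\<close> turns the sum over
  \<open>N\<close> points into \<open>comb\<close>, so the row space is mapped injectively and
  \<open>card_row_space\<close> applies.\<close>

lemma card_row_points:
  assumes K: "K \<in> carrier_mat r N"
  shows "card (row_points K) = CARD('a) ^ vec_space.rank r K"
proof -
  let ?f = "\<lambda>v. \<Sum>i<N. to_ac (v $ i) * g i"
  define pad :: "'a vec \<Rightarrow> 'a vec" where "pad v = vec d (\<lambda>i. if i < N then v $ i else 0)" for v
  have f: "?f v = comb (pad v)" for v
    unfolding comb_def pad_def using d(2) by (intro sum.mono_neutral_cong_left) auto
  have "inj_on ?f (carrier_vec N)"
  proof (rule inj_onI)
    fix v w :: "'a vec" assume vw: "v \<in> carrier_vec N" "w \<in> carrier_vec N" "?f v = ?f w"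
    have "pad v = pad w"
      using inj_onD[OF bij_betw_imp_inj_on[OF bij_comb]] vw(3) unfolding f by (simp add: pad_def)
    have "v $ i = w $ i" if "i < N" for i
      using arg_cong[OF \<open>pad v = pad w\<close>, of "\<lambda>x. x $ i"] that d(2) by (simp add: pad_def)
    then show "v = w"
      using vw by (intro eq_vecI) auto
  qed
  moreover have "(*\<^sub>v) K\<^sup>T ` carrier_vec r \<subseteq> carrier_vec N"
    using K by auto
  ultimately have "card (row_points K) = card ((*\<^sub>v) K\<^sup>T ` carrier_vec r)"
    unfolding row_points_def using K by (auto intro: card_image inj_on_subset)
  then show ?thesis
    using card_row_space[OF K] by simp
qed

text \<open>Equal payloads give equal values at the points of \<open>K\<close>, hence on its
  \<open>q ^ n\<close> row points, which exceeds the number of roots possible for the difference.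
  This is what lets the receiver decode without prior knowledge of the channel.\<close>

lemma codeword_determined:
  assumes K: "K \<in> carrier_mat r N" "vec_space.rank r K = n" and K': "K' \<in> carrier_mat r N"
    and u: "u \<in> {..<n} \<rightarrow> galois d" and v: "v \<in> {..<n} \<rightarrow> galois d"
    and eq: "K * codeword u = K' * codeword v" and j: "j < n"
  shows "u j = v j"
proof -
  have "lin_poly n u (point K a) = lin_poly n v (point K a)" if "a < r" for a
    using mult_codeword_eq_iff[OF K(1) K' u v] eq that by blast
  then have "lin_poly n u x = lin_poly n v x" if "x \<in> row_points K" for x
    using that by (auto simp: row_points_eq[OF K(1)] lin_poly_sum)
  moreover have "CARD('a) ^ n \<le> card (row_points K)"
    using card_row_points[OF K(1)] unfolding K(2) by simp
  ultimately show ?thesis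
    by (rule lin_poly_coeffs_unique[OF _ _ j])
qed

text \<open>The headers agree since \<open>K\<close> is the same on both sides. For the payloads,
  rerandomization is applied to the \<open>q ^ m\<close> row points, which include all points of
  \<open>K\<close>.\<close>

lemma codeword_rerandomize:
  assumes K: "K \<in> carrier_mat r N" "vec_space.rank r K = m" and m: "m \<le> n"
    and s: "s \<in> {m..<n} \<rightarrow> galois d" "s' \<in> {m..<n} \<rightarrow> galois d"
  obtains h where "bij_betw h ({..<m} \<rightarrow>\<^sub>E galois d) ({..<m} \<rightarrow>\<^sub>E galois d)"
    "\<And>t. t \<in> {..<m} \<rightarrow>\<^sub>E galois d \<Longrightarrow>
      K * codeword (join_coeffs m t s) = K * codeword (join_coeffs m (h t) s')"
proof -
  obtain h where h: "bij_betw h ({..<m} \<rightarrow>\<^sub>E galois d) ({..<m} \<rightarrow>\<^sub>E galois d)"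
    "\<And>t x. t \<in> {..<m} \<rightarrow>\<^sub>E galois d \<Longrightarrow> x \<in> row_points K \<Longrightarrow>
      lin_poly n (join_coeffs m t s) x = lin_poly n (join_coeffs m (h t) s') x"
    by (rule lin_poly_rerandomize[OF d(1) subspace_row_points[OF K(1)] row_points_subset_galois _ m s])
      (use card_row_points[OF K(1)] K(2) in auto)
  show thesis
  proof (rule that[OF h(1)])
    fix t assume t: "t \<in> {..<m} \<rightarrow>\<^sub>E (galois d :: 'a alg_closure set)"
    then have "h t \<in> {..<m} \<rightarrow>\<^sub>E galois d"
      by (rule bij_betw_apply[OF h(1)])
    with t s have "join_coeffs m t s \<in> {..<n} \<rightarrow> galois d" "join_coeffs m (h t) s' \<in> {..<n} \<rightarrow> galois d"
      by (auto simp: join_coeffs_def PiE_iff Pi_iff)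
    then show "K * codeword (join_coeffs m t s) = K * codeword (join_coeffs m (h t) s')"
      using h(2)[OF t] point_in_row_points[OF K(1)] by (subst mult_codeword_eq_iff[OF K(1) K(1)]) auto
  qed
qed

end

section \<open>Observations and information leakage\<close>

text \<open>The bijections \<open>h\<close> make the number of scramble values leading to a given
  observation independent of the message. Joint probabilities are then products of the
  marginals.\<close>

lemma leaked_info_eq_0:
  fixes \<Phi> :: "('a :: {field, finite}, 'm, 's) net_code"
  assumes code: "is_code m3 m4 l \<Phi>"
    and rerandomize: "\<And>m m'. m \<in> messages \<Phi> \<Longrightarrow> m' \<in> messages \<Phi> \<Longrightarrow>
      \<exists>h. bij_betw h (scrambles \<Phi>) (scrambles \<Phi>) \<and>
        (\<forall>s\<in>scrambles \<Phi>. eve_obs K H \<alpha> (encode \<Phi> (m, s)) = eve_obs K H \<alpha> (encode \<Phi> (m', h s)))"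
  shows "leaked_info \<Phi> K H \<alpha> = 0"
proof -
  let ?M = "messages \<Phi>" and ?S = "scrambles \<Phi>"
  let ?Y = "\<lambda>\<omega>. eve_obs K H \<alpha> (encode \<Phi> \<omega>)"
  have fin: "finite ?M" "?M \<noteq> {}" "finite ?S" "?S \<noteq> {}"
    using code by (auto simp: is_code_def)
  interpret prob_space "code_space \<Phi>"
    unfolding code_space_def using fin by (intro prob_space_uniform_count_measure) auto
  interpret information_space "code_space \<Phi>" 2
    by unfold_locales simp
  have space: "space (code_space \<Phi>) = ?M \<times> ?S"
    by (simp add: code_space_def space_uniform_count_measure)
  have sets: "sets (code_space \<Phi>) = Pow (?M \<times> ?S)"
    by (simp add: code_space_def sets_uniform_count_measure)
  have simple: "simple_function (code_space \<Phi>) U" for U :: "'m \<times> 's \<Rightarrow> 'x"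
    using fin by (auto simp: simple_function_def space sets)
  have prob: "prob A = card A / card (?M \<times> ?S)" if "A \<subseteq> ?M \<times> ?S" for A
    using that fin by (simp add: code_space_def measure_uniform_count_measure)
  define N where "N m y = card {s \<in> ?S. ?Y (m, s) = y}" for m y
  have N_le: "N m y \<le> N m' y" if mm': "m \<in> ?M" "m' \<in> ?M" for m m' y
  proof -
    obtain h where h: "bij_betw h ?S ?S" "\<And>s. s \<in> ?S \<Longrightarrow> ?Y (m, s) = ?Y (m', h s)"
      using rerandomize[OF mm'] by blast
    have "h ` {s \<in> ?S. ?Y (m, s) = y} \<subseteq> {s \<in> ?S. ?Y (m', s) = y}"
      using h by (auto simp: bij_betw_def)
    moreover have "inj_on h {s \<in> ?S. ?Y (m, s) = y}"
      using h(1) by (auto simp: bij_betw_def intro: inj_on_subset)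
    ultimately show ?thesis
      unfolding N_def using fin by (intro card_inj_on_le) auto
  qed
  then have N_eq: "N m y = N m' y" if "m \<in> ?M" "m' \<in> ?M" for m m' y
    using that by (meson le_antisym)
  have joint: "card {\<omega> \<in> ?M \<times> ?S. fst \<omega> = m \<and> ?Y \<omega> = y} = N m y" if "m \<in> ?M" for m y
  proof -
    have "{\<omega> \<in> ?M \<times> ?S. fst \<omega> = m \<and> ?Y \<omega> = y} = Pair m ` {s \<in> ?S. ?Y (m, s) = y}"
      using that by auto
    then show ?thesis by (simp add: N_def card_image inj_on_def)
  qed
  have marginal: "card {\<omega> \<in> ?M \<times> ?S. ?Y \<omega> = y} = card ?M * N m y" if "m \<in> ?M" for m y
  proof -
    have "{\<omega> \<in> ?M \<times> ?S. ?Y \<omega> = y} = (SIGMA m':?M. {s \<in> ?S. ?Y (m', s) = y})"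
      by auto
    also have "card \<dots> = (\<Sum>m'\<in>?M. N m' y)"
      unfolding N_def using fin by (intro card_SigmaI) auto
    also have "\<dots> = (\<Sum>m'\<in>?M. N m y)"
      using N_eq[OF _ that] by (rule sum.cong[OF refl])
    also have "\<dots> = card ?M * N m y"
      by simp
    finally show ?thesis .
  qed
  have message: "card {\<omega> \<in> ?M \<times> ?S. fst \<omega> = m} = card ?S" if "m \<in> ?M" for m
  proof -
    have "{\<omega> \<in> ?M \<times> ?S. fst \<omega> = m} = {m} \<times> ?S" using that by auto
    then show ?thesis by (simp add: card_cartesian_product)
  qed
  have card: "real (card ?M) > 0" "real (card ?S) > 0"
    using fin by (auto simp: card_gt_0_iff)
  have "mutual_information 2 (count_space (fst ` space (code_space \<Phi>)))
      (count_space (?Y ` space (code_space \<Phi>))) fst ?Y = 0"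
  proof (rule mutual_information_eq_0_simple)
    show "simple_distributed (code_space \<Phi>) fst
        (\<lambda>m. prob (fst -` {m} \<inter> space (code_space \<Phi>)))"
      by (rule simple_distributedI) (auto simp: simple)
    show "simple_distributed (code_space \<Phi>) ?Y
        (\<lambda>y. prob (?Y -` {y} \<inter> space (code_space \<Phi>)))"
      by (rule simple_distributedI) (auto simp: simple)
    show "simple_distributed (code_space \<Phi>) (\<lambda>\<omega>. (fst \<omega>, ?Y \<omega>))
        (\<lambda>z. prob ((\<lambda>\<omega>. (fst \<omega>, ?Y \<omega>)) -` {z} \<inter> space (code_space \<Phi>)))"
      by (rule simple_distributedI) (auto simp: simple)
    show "\<forall>\<omega>\<in>space (code_space \<Phi>).
        prob ((\<lambda>\<omega>. (fst \<omega>, ?Y \<omega>)) -` {(fst \<omega>, ?Y \<omega>)} \<inter> space (code_space \<Phi>)) =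
        prob (fst -` {fst \<omega>} \<inter> space (code_space \<Phi>)) *
        prob (?Y -` {?Y \<omega>} \<inter> space (code_space \<Phi>))"
    proof
      fix \<omega> assume "\<omega> \<in> space (code_space \<Phi>)"
      then have m: "fst \<omega> \<in> ?M" by (auto simp: space)
      have eqs: "(\<lambda>\<omega>. (fst \<omega>, ?Y \<omega>)) -` {(fst \<omega>, ?Y \<omega>)} \<inter> space (code_space \<Phi>)
          = {\<omega>' \<in> ?M \<times> ?S. fst \<omega>' = fst \<omega> \<and> ?Y \<omega>' = ?Y \<omega>}"
        "fst -` {fst \<omega>} \<inter> space (code_space \<Phi>) = {\<omega>' \<in> ?M \<times> ?S. fst \<omega>' = fst \<omega>}"
        "?Y -` {?Y \<omega>} \<inter> space (code_space \<Phi>) = {\<omega>' \<in> ?M \<times> ?S. ?Y \<omega>' = ?Y \<omega>}"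
        by (auto simp: space)
      \<comment> \<open>With \<open>c\<close> messages, \<open>s\<close> scramble values and
        \<open>N\<close> for \<open>N (fst \<omega>) (?Y \<omega>)\<close>, this is
        \<open>N / (c * s) = (s / (c * s)) * (c * N / (c * s))\<close>.\<close>
      show "prob ((\<lambda>\<omega>. (fst \<omega>, ?Y \<omega>)) -` {(fst \<omega>, ?Y \<omega>)} \<inter> space (code_space \<Phi>)) =
        prob (fst -` {fst \<omega>} \<inter> space (code_space \<Phi>)) *
        prob (?Y -` {?Y \<omega>} \<inter> space (code_space \<Phi>))"
        unfolding eqs using card
        by (subst (1 2 3) prob; (auto)?)
          (simp only: joint[OF m] marginal[OF m] message[OF m] card_cartesian_product, simp add: field_simps)
    qed
  qed
  then show ?thesis
    by (simp add: leaked_info_def)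
qed

text \<open>The input enters the fixed-point equation only through \<open>snd K * U\<close>, and its
  domain through the number of columns. So an active attack distinguishes no inputs that passive
  observation does not.\<close>

lemma eve_obs_cong:
  assumes "snd K * U = snd K * V" "dim_col U = dim_col V"
  shows "eve_obs K H \<alpha> U = eve_obs K H \<alpha> V"
  using assms by (simp add: eve_obs_def)

lemma eve_obs_zero_strategy:
  assumes "KE \<in> carrier_mat m6 m3" "HE \<in> carrier_mat m6 m5" "U \<in> carrier_mat m3 l"
  shows "eve_obs (KB, KE) (HB, HE) (zero_strategy m5 m6 l) U = KE * U"
  unfolding eve_obs_def
proof (rule the_equality)
  show "KE * U \<in> carrier_mat (dim_row (snd (KB, KE))) (dim_col U) \<and>
      KE * U = snd (KB, KE) * U + snd (HB, HE) * zero_strategy m5 m6 l (KE * U)"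
    using assms by (simp add: zero_strategy_def)
next
  fix Y assume "Y \<in> carrier_mat (dim_row (snd (KB, KE))) (dim_col U) \<and>
      Y = snd (KB, KE) * U + snd (HB, HE) * zero_strategy m5 m6 l Y"
  then show "Y = KE * U"
    using assms by (auto simp: zero_strategy_def)
qed

lemma bob_obs_zero_strategy:
  assumes "KB \<in> carrier_mat m4 m3" "KE \<in> carrier_mat m6 m3"
    "HB \<in> carrier_mat m4 m5" "HE \<in> carrier_mat m6 m5" "U \<in> carrier_mat m3 l"
  shows "bob_obs (KB, KE) (HB, HE) (zero_strategy m5 m6 l) U = KB * U"
  unfolding bob_obs_def eve_obs_zero_strategy[OF assms(2,4,5)]
  using assms by (simp add: zero_strategy_def)

section \<open>The secret codes\<close>

text \<open>Message vectors and scramble numbers are matched with coefficient tuples by arbitrary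
  bijections, as only cardinalities matter. The decoder depends on the number \<open>r\<close> of
  received rows, whereas hiding holds for any number \<open>r'\<close> of observed rows.\<close>

lemma (in gabidulin) code_exists:
  assumes m: "m \<le> n"
  obtains \<Phi> :: "('a, 'a vec, nat) net_code"
  where "is_code N r (N + d) \<Phi>" "messages \<Phi> = carrier_vec (d * (n - m))"
    "\<And>K M S. K \<in> carrier_mat r N \<Longrightarrow> vec_space.rank r K = n \<Longrightarrow>
      M \<in> messages \<Phi> \<Longrightarrow> S \<in> scrambles \<Phi> \<Longrightarrow> decode \<Phi> (K * encode \<Phi> (M, S)) = M"
    "\<And>K r' M M'. K \<in> carrier_mat r' N \<Longrightarrow> vec_space.rank r' K = m \<Longrightarrow>
      M \<in> messages \<Phi> \<Longrightarrow> M' \<in> messages \<Phi> \<Longrightarrow>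
      \<exists>h. bij_betw h (scrambles \<Phi>) (scrambles \<Phi>) \<and>
        (\<forall>S\<in>scrambles \<Phi>. K * encode \<Phi> (M, S) = K * encode \<Phi> (M', h S))"
proof -
  let ?G = "galois d :: 'a alg_closure set"
  let ?M = "carrier_vec (d * (n - m)) :: 'a vec set"
  let ?S = "{..<CARD('a) ^ (d * m)}"
  have fin: "finite ({m..<n} \<rightarrow>\<^sub>E ?G)" "finite ({..<m} \<rightarrow>\<^sub>E ?G)"
    using d(1) by (auto intro!: finite_PiE finite_galois)
  have "card ?M = card ({m..<n} \<rightarrow>\<^sub>E ?G)"
    using d(1) by (simp add: card_carrier_vec card_PiE card_galois power_mult)
  then obtain \<mu> where \<mu>: "bij_betw \<mu> ?M ({m..<n} \<rightarrow>\<^sub>E ?G)"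
    using finite_same_card_bij[OF finite_carrier_vec fin(1)] by blast
  have "card ?S = card ({..<m} \<rightarrow>\<^sub>E ?G)"
    using d(1) by (simp add: card_PiE card_galois power_mult)
  then obtain \<sigma> where \<sigma>: "bij_betw \<sigma> ?S ({..<m} \<rightarrow>\<^sub>E ?G)"
    using finite_same_card_bij[OF finite_lessThan fin(2)] by blast
  define enc where "enc = (\<lambda>(M, S). codeword (join_coeffs m (\<sigma> S) (\<mu> M)))"
  \<comment> \<open>\<open>M\<close> is a candidate for \<open>Y\<close> if some scramble value and
    some channel of rank \<open>n\<close> explain \<open>Y\<close>.\<close>
  define P where "P Y M \<longleftrightarrow> M \<in> ?M \<and>
    (\<exists>S\<in>?S. \<exists>K\<in>carrier_mat r N. vec_space.rank r K = n \<and> Y = K * enc (M, S))" for Y M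
  \<comment> \<open>The zero vector is the default for a \<open>Y\<close> without candidates, so
    that decoding always yields a message.\<close>
  define dec where "dec Y = (if \<exists>M. P Y M then SOME M. P Y M else 0\<^sub>v (d * (n - m)))" for Y
  define \<Phi> where "\<Phi> = \<lparr>messages = ?M, scrambles = ?S, encode = enc, decode = dec\<rparr>"
  have coeffs: "join_coeffs m (\<sigma> S) (\<mu> M) \<in> {..<n} \<rightarrow> ?G" if "M \<in> ?M" "S \<in> ?S" for M S
    using bij_betw_apply[OF \<mu> that(1)] bij_betw_apply[OF \<sigma> that(2)]
    by (auto simp: join_coeffs_def PiE_iff)
  show thesis
  proof (rule that[of \<Phi>])
    have "dec Y \<in> ?M" for Y
    proof (cases "\<exists>M. P Y M")
      case True
      then show ?thesis
        using someI_ex[OF True] unfolding dec_def P_def[of Y "Eps (P Y)"] by simp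
    qed (simp add: dec_def)
    then show "is_code N r (N + d) \<Phi>"
      using codeword_carrier by (auto simp: is_code_def \<Phi>_def enc_def finite_carrier_vec
          simp flip: ex_in_conv intro: exI[of _ "0\<^sub>v (d * (n - m))"] exI[of _ 0])
    show "messages \<Phi> = ?M" by (simp add: \<Phi>_def)
  next
    fix K :: "'a mat" and M S
    assume K: "K \<in> carrier_mat r N" "vec_space.rank r K = n"
      and MS: "M \<in> messages \<Phi>" "S \<in> scrambles \<Phi>"
    let ?Y = "K * enc (M, S)"
    have MS': "M \<in> ?M" "S \<in> ?S" using MS by (simp_all add: \<Phi>_def)
    have "P ?Y M"
      unfolding P_def using K MS' by blast
    \<comment> \<open>By \<open>codeword_determined\<close>, all candidates share their
      coefficients, and those from \<open>m\<close> on are the message.\<close>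
    moreover have "M' = M" if "P ?Y M'" for M'
    proof -
      obtain S' K' where M': "M' \<in> ?M" "S' \<in> ?S" "K' \<in> carrier_mat r N" "?Y = K' * enc (M', S')"
        using \<open>P ?Y M'\<close> by (auto simp: P_def)
      have join_eq: "join_coeffs m (\<sigma> S) (\<mu> M) j = join_coeffs m (\<sigma> S') (\<mu> M') j" if "j < n" for j
        using M'(4) codeword_determined[OF K M'(3) coeffs[OF MS'] coeffs[OF M'(1,2)] _ that]
        by (simp add: enc_def)
      have "\<mu> M j = \<mu> M' j" if "j \<in> {m..<n}" for j
        using join_eq[of j] that by (auto simp: join_coeffs_def split: if_splits)
      then have "\<mu> M = \<mu> M'"
        by (rule PiE_ext[OF bij_betw_apply[OF \<mu> MS'(1)] bij_betw_apply[OF \<mu> M'(1)]])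
      then show "M' = M"
        using inj_onD[OF bij_betw_imp_inj_on[OF \<mu>]] MS'(1) M'(1) by metis
    qed
    ultimately have "dec ?Y = M"
      unfolding dec_def by (metis someI)
    then show "decode \<Phi> (K * encode \<Phi> (M, S)) = M"
      by (simp add: \<Phi>_def)
  next
    fix K :: "'a mat" and r' M M'
    assume K: "K \<in> carrier_mat r' N" "vec_space.rank r' K = m"
      and "M \<in> messages \<Phi>" "M' \<in> messages \<Phi>"
    then have M: "\<mu> M \<in> {m..<n} \<rightarrow> ?G" "\<mu> M' \<in> {m..<n} \<rightarrow> ?G"
      using bij_betw_apply[OF \<mu>] by (auto simp: \<Phi>_def PiE_iff)
    obtain h where h: "bij_betw h ({..<m} \<rightarrow>\<^sub>E ?G) ({..<m} \<rightarrow>\<^sub>E ?G)"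
      "\<And>t. t \<in> {..<m} \<rightarrow>\<^sub>E ?G \<Longrightarrow>
        K * codeword (join_coeffs m t (\<mu> M)) = K * codeword (join_coeffs m (h t) (\<mu> M'))"
      using codeword_rerandomize[OF K m M] by metis
    \<comment> \<open>The rerandomization of coefficient tuples is carried over to scramble numbers
      by conjugation with \<open>\<sigma>\<close>.\<close>
    let ?h = "inv_into ?S \<sigma> \<circ> (h \<circ> \<sigma>)"
    have "bij_betw ?h ?S ?S"
      by (intro bij_betw_trans[OF bij_betw_trans[OF \<sigma> h(1)] bij_betw_inv_into[OF \<sigma>]])
    moreover have "K * enc (M, S) = K * enc (M', ?h S)" if "S \<in> ?S" for S
    proof -
      have S: "\<sigma> S \<in> {..<m} \<rightarrow>\<^sub>E ?G"
        using \<sigma> that by (rule bij_betw_apply)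
      then have "\<sigma> (?h S) = h (\<sigma> S)"
        by (simp add: bij_betw_inv_into_right[OF \<sigma> bij_betw_apply[OF h(1)]])
      then show ?thesis
        using h(2)[OF S] by (simp add: enc_def)
    qed
    ultimately show "\<exists>h. bij_betw h (scrambles \<Phi>) (scrambles \<Phi>) \<and>
        (\<forall>S\<in>scrambles \<Phi>. K * encode \<Phi> (M, S) = K * encode \<Phi> (M', h S))"
      by (intro exI[of _ ?h]) (simp add: \<Phi>_def)
  qed
qed

section \<open>From one code for all channels to the limit\<close>

lemma error_prob_eq_0:
  assumes "is_code m3 m4 l \<Phi>"
    and "\<And>M S. M \<in> messages \<Phi> \<Longrightarrow> S \<in> scrambles \<Phi> \<Longrightarrow> decode \<Phi> (bob_obs K H \<alpha> (encode \<Phi> (M, S))) = M"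
  shows "error_prob \<Phi> K H \<alpha> = 0"
proof -
  have "{\<omega> \<in> space (code_space \<Phi>). decode \<Phi> (bob_obs K H \<alpha> (encode \<Phi> \<omega>)) \<noteq> fst \<omega>} = {}"
    using assms(2) by (auto simp: code_space_def space_uniform_count_measure)
  then show ?thesis
    unfolding error_prob_def by (simp only: measure_empty)
qed

lemma Max_image_eq_0:
  fixes f :: "'b \<Rightarrow> real"
  assumes "A \<noteq> {}" "\<And>x. x \<in> A \<Longrightarrow> f x = 0"
  shows "Max (f ` A) = 0"
proof -
  have "f ` A = {0}" using assms by auto
  then show ?thesis by simp
qed

lemma K_set_nonempty:
  assumes "m0 \<le> min m3 m4" "m2 \<le> min m6 m3"
  shows "(K_set m0 m2 m3 m4 m6 :: 'a :: {field, finite} mat_pair set) \<noteq> {}"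
  using exists_mat_rank[of m0 m4 m3, where 'a = 'a] exists_mat_rank[of m2 m6 m3, where 'a = 'a] assms
  by (auto simp: K_set_def)

lemma H_set_nonempty:
  assumes "m1 \<le> min m4 m5"
  shows "(H_set m1 m4 m5 m6 :: 'a :: {field, finite} mat_pair set) \<noteq> {}"
  using exists_mat_rank[of m1 m4 m5, where 'a = 'a] zero_carrier_mat[of m6 m5, where 'a = 'a] assms
  by (auto simp: H_set_def)

text \<open>The Gabidulin construction is used with \<open>m0\<close> coefficients,
  \<open>m2\<close> of them scrambled, at \<open>m3\<close> points. Error and leakage are exactly 0
  for this single code, so only the rate is left to a limit.\<close>

lemma zero_error_secret_code:
  fixes m0 m1 m2 m3 m4 m5 m6 :: nat
  assumes "m3 \<le> d" "0 < d"
    and m: "m0 \<le> min m3 m4" "m1 \<le> min m4 m5" "m2 \<le> min m6 m3" "m2 < m0"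
  shows "\<exists>\<Phi> :: ('a :: {field, finite}, 'a vec, nat) net_code.
    is_code m3 m4 (m3 + d) \<Phi> \<and> messages \<Phi> = carrier_vec (d * (m0 - m2)) \<and>
    (MAX K \<in> K_set m0 m2 m3 m4 m6.
      error_prob \<Phi> K (zero_H m4 m5 m6) (zero_strategy m5 m6 (m3 + d))) = 0 \<and>
    (MAX (K, H) \<in> K_set m0 m2 m3 m4 m6 \<times> H_set m1 m4 m5 m6.
      error_prob \<Phi> K H (zero_strategy m5 m6 (m3 + d))) = 0 \<and>
    (MAX (K, H) \<in> K_set m0 m2 m3 m4 m6 \<times> H_set m1 m4 m5 m6.
      MAX \<alpha> \<in> strategies (m3 + d) (snd K) (snd H). leaked_info \<Phi> K H \<alpha>) = 0"
proof -
  obtain g :: "nat \<Rightarrow> 'a alg_closure" where g: "\<And>i. i < d \<Longrightarrow> g i \<in> galois d"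
    "bij_betw (\<lambda>v. \<Sum>i<d. to_ac (v $ i) * g i) (carrier_vec d) (galois d)"
    using galois_basis[OF \<open>0 < d\<close>] by blast
  interpret gabidulin d m0 m3 g
    using assms g by unfold_locales auto
  obtain \<Phi> :: "('a, 'a vec, nat) net_code"
    where code: "is_code m3 m4 (m3 + d) \<Phi>" and messages: "messages \<Phi> = carrier_vec (d * (m0 - m2))"
    and decode: "\<And>K M S. K \<in> carrier_mat m4 m3 \<Longrightarrow> vec_space.rank m4 K = m0 \<Longrightarrow>
      M \<in> messages \<Phi> \<Longrightarrow> S \<in> scrambles \<Phi> \<Longrightarrow> decode \<Phi> (K * encode \<Phi> (M, S)) = M"
    and hide: "\<And>K r' M M'. K \<in> carrier_mat r' m3 \<Longrightarrow> vec_space.rank r' K = m2 \<Longrightarrow>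
      M \<in> messages \<Phi> \<Longrightarrow> M' \<in> messages \<Phi> \<Longrightarrow>
      \<exists>h. bij_betw h (scrambles \<Phi>) (scrambles \<Phi>) \<and>
        (\<forall>S\<in>scrambles \<Phi>. K * encode \<Phi> (M, S) = K * encode \<Phi> (M', h S))"
    by (rule code_exists[of m2 m4]) (use m in auto)
  have carrier: "encode \<Phi> (M, S) \<in> carrier_mat m3 (m3 + d)"
    if "M \<in> messages \<Phi>" "S \<in> scrambles \<Phi>" for M S
    using code that by (auto simp: is_code_def)
  have error: "error_prob \<Phi> K H (zero_strategy m5 m6 (m3 + d)) = 0"
    if K: "K \<in> K_set m0 m2 m3 m4 m6" and H: "fst H \<in> carrier_mat m4 m5" "snd H \<in> carrier_mat m6 m5"
    for K H
  proof (rule error_prob_eq_0[OF code])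
    fix M S assume MS: "M \<in> messages \<Phi>" "S \<in> scrambles \<Phi>"
    obtain KB KE HB HE where KH: "K = (KB, KE)" "H = (HB, HE)" by (metis surj_pair)
    then have "bob_obs K H (zero_strategy m5 m6 (m3 + d)) (encode \<Phi> (M, S)) = KB * encode \<Phi> (M, S)"
      using K H carrier[OF MS] by (auto simp: K_set_def intro!: bob_obs_zero_strategy)
    then show "decode \<Phi> (bob_obs K H (zero_strategy m5 m6 (m3 + d)) (encode \<Phi> (M, S))) = M"
      using K MS KH decode by (auto simp: K_set_def)
  qed
  \<comment> \<open>Hiding is a property of \<open>snd K\<close>, so \<open>H\<close> and the
    strategy stay arbitrary.\<close>
  have leak: "leaked_info \<Phi> K H \<alpha> = 0" if K: "K \<in> K_set m0 m2 m3 m4 m6" for K H \<alpha>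
  proof (rule leaked_info_eq_0[OF code])
    fix M M' assume M: "M \<in> messages \<Phi>" "M' \<in> messages \<Phi>"
    have "snd K \<in> carrier_mat m6 m3" "vec_space.rank m6 (snd K) = m2"
      using K by (auto simp: K_set_def)
    from hide[OF this M] obtain h where h: "bij_betw h (scrambles \<Phi>) (scrambles \<Phi>)"
      "\<And>S. S \<in> scrambles \<Phi> \<Longrightarrow> snd K * encode \<Phi> (M, S) = snd K * encode \<Phi> (M', h S)"
      by blast
    have "eve_obs K H \<alpha> (encode \<Phi> (M, S)) = eve_obs K H \<alpha> (encode \<Phi> (M', h S))"
      if S: "S \<in> scrambles \<Phi>" for S
      using h(2)[OF S] carrier[OF M(1) S] carrier[OF M(2) bij_betw_apply[OF h(1) S]]
      by (intro eve_obs_cong) auto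
    with h(1) show "\<exists>h. bij_betw h (scrambles \<Phi>) (scrambles \<Phi>) \<and> (\<forall>S\<in>scrambles \<Phi>.
        eve_obs K H \<alpha> (encode \<Phi> (M, S)) = eve_obs K H \<alpha> (encode \<Phi> (M', h S)))"
      by blast
  qed
  have "K_set m0 m2 m3 m4 m6 \<noteq> ({} :: 'a mat_pair set)" "H_set m1 m4 m5 m6 \<noteq> ({} :: 'a mat_pair set)"
    using K_set_nonempty[OF m(1,3)] H_set_nonempty[OF m(2)] by auto
  note nonempty = this
  show ?thesis
  proof (intro exI[of _ \<Phi>] conjI code messages)
    show "(MAX K \<in> K_set m0 m2 m3 m4 m6.
        error_prob \<Phi> K (zero_H m4 m5 m6) (zero_strategy m5 m6 (m3 + d))) = 0"
      using nonempty by (intro Max_image_eq_0 error) (auto simp: zero_H_def)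
    show "(MAX (K, H) \<in> K_set m0 m2 m3 m4 m6 \<times> H_set m1 m4 m5 m6.
        error_prob \<Phi> K H (zero_strategy m5 m6 (m3 + d))) = 0"
      using nonempty by (intro Max_image_eq_0) (auto simp: H_set_def intro!: error)
    have "(MAX \<alpha> \<in> strategies (m3 + d) (snd K) (snd H). leaked_info \<Phi> K H \<alpha>) = 0"
      if "K \<in> K_set m0 m2 m3 m4 m6" "H \<in> H_set m1 m4 m5 m6" for K H
    proof (rule Max_image_eq_0)
      \<comment> \<open>The zero strategy is the witness that keeps the inner maximum
        meaningful.\<close>
      show "strategies (m3 + d) (snd K) (snd H) \<noteq> {}"
        using that zero_strategy_in_strategies[of "snd K" m6 m3 "snd H" m5 "m3 + d"]
        by (auto simp: K_set_def H_set_def)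
    qed (rule leak[OF that(1)])
    then show "(MAX (K, H) \<in> K_set m0 m2 m3 m4 m6 \<times> H_set m1 m4 m5 m6.
        MAX \<alpha> \<in> strategies (m3 + d) (snd K) (snd H). leaked_info \<Phi> K H \<alpha>) = 0"
      using nonempty by (intro Max_image_eq_0) auto
  qed
qed

theorem theorem3:
  fixes m0 m1 m2 m3 m4 m5 m6 :: nat
  assumes "0 < m3" "0 < m4" "0 < m5" "0 < m6"
    and "m0 \<le> min m3 m4" "m1 \<le> min m4 m5" "m2 \<le> min m6 m3" "m2 < m0"
  shows "\<exists>(l :: nat \<Rightarrow> nat) (k :: nat \<Rightarrow> nat)
           (\<Phi> :: nat \<Rightarrow> ('a :: {field, finite}, 'a vec, nat) net_code).
     (\<forall>n\<ge>1. 0 < l n \<and> is_code m3 m4 (l n) (\<Phi> n) \<and> messages (\<Phi> n) = carrier_vec (k n)) \<and>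
     (\<lambda>n. real (k n) / real (l n)) \<longlonglongrightarrow> real m0 - real m2 \<and>
     (\<lambda>n. MAX K \<in> K_set m0 m2 m3 m4 m6.
            error_prob (\<Phi> n) K (zero_H m4 m5 m6) (zero_strategy m5 m6 (l n))) \<longlonglongrightarrow> 0 \<and>
     (\<lambda>n. MAX (K, H) \<in> K_set m0 m2 m3 m4 m6 \<times> H_set m1 m4 m5 m6.
            error_prob (\<Phi> n) K H (zero_strategy m5 m6 (l n))) \<longlonglongrightarrow> 0 \<and>
     (\<forall>n\<ge>1. (MAX (K, H) \<in> K_set m0 m2 m3 m4 m6 \<times> H_set m1 m4 m5 m6.
            MAX \<alpha> \<in> strategies (l n) (snd K) (snd H). leaked_info (\<Phi> n) K H \<alpha>) = 0)"
proof -
  \<comment> \<open>The degree is \<open>d = m3 + n\<close>, which is at least \<open>m3\<close> and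
    tends to infinity; the first summand \<open>m3\<close> is the header.\<close>
  define l where "l n = m3 + (m3 + n)" for n
  define k where "k n = (m3 + n) * (m0 - m2)" for n
  define good :: "nat \<Rightarrow> ('a, 'a vec, nat) net_code \<Rightarrow> bool" where
    "good n \<Phi> \<longleftrightarrow> is_code m3 m4 (l n) \<Phi> \<and> messages \<Phi> = carrier_vec (k n) \<and>
      (MAX K \<in> K_set m0 m2 m3 m4 m6.
        error_prob \<Phi> K (zero_H m4 m5 m6) (zero_strategy m5 m6 (l n))) = 0 \<and>
      (MAX (K, H) \<in> K_set m0 m2 m3 m4 m6 \<times> H_set m1 m4 m5 m6.
        error_prob \<Phi> K H (zero_strategy m5 m6 (l n))) = 0 \<and>
      (MAX (K, H) \<in> K_set m0 m2 m3 m4 m6 \<times> H_set m1 m4 m5 m6.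
        MAX \<alpha> \<in> strategies (l n) (snd K) (snd H). leaked_info \<Phi> K H \<alpha>) = 0" for n \<Phi>
  have "\<exists>\<Phi>. good n \<Phi>" for n
    unfolding good_def l_def k_def
    by (rule zero_error_secret_code) (use assms in auto)
  then obtain \<Phi> where \<Phi>: "\<And>n. good n (\<Phi> n)" by metis
  have "(\<lambda>n. (real m3 + real n) * (real m0 - real m2) / (real m3 + (real m3 + real n)))
      \<longlonglongrightarrow> real m0 - real m2"
    by real_asymp
  then have "(\<lambda>n. real (k n) / real (l n)) \<longlonglongrightarrow> real m0 - real m2"
    using \<open>m2 < m0\<close> by (simp add: k_def l_def of_nat_diff)
  then show ?thesis
    using \<Phi> \<open>0 < m3\<close> unfolding good_def
    by (intro exI[of _ l] exI[of _ k] exI[of _ \<Phi>]) (simp add: l_def)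
qed

end
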